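(* Let $S$ be a compact translation surface and let $Z = V_{\mathrm{sc}}(S)$ be the set of saddle connection vectors of $S$. Then \[ \mu(Z) \le \pi \,\mathrm{vol}(S), \] where $\mathrm{vol}(S)$ is the Lebesgue area of $S$.
   Context: A translation surface is a real surface with an atlas whose transition functions, off a finite set of points, are translations; it inherits a flat metric with conical singularities at these points and a Lebesgue area $\mathrm{vol}(S)$. A saddle connection is a geodesic segment joining singularities with no singularity in its interior; reading it in local coordinates gives a vector in $\mathbb{R}^2$, and $V_{\mathrm{sc}}(S)$ is the set of these vectors. For a discrete set $Z\subset\mathbb{R}^2$ not containing $0$, the Minkowski constant is $\mu(Z) = \frac14 \sup \mathrm{area}(\mathcal{C})$, the supremum over all bounded convex sets $\mathcal{C}\subset\mathbb{R}^2$ symmetric about the origin and disjoint from $Z$.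
   Formalization: The surface is assumed to have at least one singularity (marked points count); for a flat torus without singularities there are no saddle connections, so the Minkowski constant is infinite and the claim fails. *)

theory Defs
  imports "HOL-Analysis.Analysis"
begin

text \<open>The plane is identified with the type of complex numbers, so that cone points can be
  described by power maps. A surface is a topology \<open>surf\<close> with a finite set \<open>sing\<close> of singularities
  and an atlas of charts \<open>(U, f)\<close> on the complement of \<open>sing\<close>.\<close>

record 'a flat_surface =
  surf :: "'a topology"
  sing :: "'a set"
  atlas :: "('a set \<times> ('a \<Rightarrow> complex)) set"

definition planar_chart :: "'a topology \<Rightarrow> 'a set \<Rightarrow> ('a \<Rightarrow> complex) \<Rightarrow> bool" where
  "planar_chart X U f \<longleftrightarrow>
     openin X U \<and> open (f ` U) \<and>
     homeomorphic_map (subtopology X U) (top_of_set (f ` U)) f"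

text \<open>The set \<open>W\<close> need not be connected, so the translation vector may depend on the component.\<close>

definition locally_translates ::
    "'a topology \<Rightarrow> 'a set \<Rightarrow> ('a \<Rightarrow> complex) \<Rightarrow> ('a \<Rightarrow> complex) \<Rightarrow> bool" where
  "locally_translates X W f g \<longleftrightarrow>
     (\<forall>p\<in>W. \<exists>N c. openin X N \<and> p \<in> N \<and> (\<forall>q\<in>N \<inter> W. f q = g q + c))"

text \<open>A cone point of total angle \<open>2 * pi * k\<close>: near \<open>p\<close> the surface is the \<open>k\<close>-fold branched cover
  \<open>z \<mapsto> z ^ k\<close> of a flat disc, and the atlas is, up to translations, the one pulled back by this
  cover. The case \<open>k = 1\<close> is a marked point.\<close>

definition cone_point :: "'a flat_surface \<Rightarrow> 'a \<Rightarrow> bool" where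
  "cone_point S p \<longleftrightarrow>
     (\<exists>k U h r. k \<ge> (1::nat) \<and> r > 0 \<and> p \<in> U \<and> U \<inter> sing S = {p} \<and>
        planar_chart (surf S) U h \<and> h ` U = ball 0 r \<and> h p = 0 \<and>
        (\<forall>(V, f)\<in>atlas S. locally_translates (surf S) (U \<inter> V) f (\<lambda>q. h q ^ k)))"

definition compact_translation_surface :: "'a flat_surface \<Rightarrow> bool" where
  "compact_translation_surface S \<longleftrightarrow>
     compact_space (surf S) \<and> connected_space (surf S) \<and> Hausdorff_space (surf S) \<and>
     finite (sing S) \<and> sing S \<subseteq> topspace (surf S) \<and>
     (\<Union>(U, f)\<in>atlas S. U) = topspace (surf S) - sing S \<and>
     (\<forall>(U, f)\<in>atlas S. planar_chart (surf S) U f) \<and>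
     (\<forall>(U, f)\<in>atlas S. \<forall>(V, g)\<in>atlas S. locally_translates (surf S) (U \<inter> V) f g) \<and>
     (\<forall>p\<in>sing S. cone_point S p)"

text \<open>The Borel measure that charges each Borel set \<open>B\<close> with the Lebesgue measure of
  \<open>f ` (B \<inter> U)\<close>.\<close>

definition chart_measure :: "'a topology \<Rightarrow> 'a set \<Rightarrow> ('a \<Rightarrow> complex) \<Rightarrow> 'a measure" where
  "chart_measure X U f =
     distr (restrict_space lborel (f ` U)) (sigma (topspace X) {W. openin X W}) (inv_into U f)"

text \<open>Transition functions preserve Lebesgue measure, so the chart measures agree on overlaps.
  Their least upper bound in the lattice of measures is therefore the measure glued from them: it is
  Lebesgue measure in every chart and does not charge the singularities.\<close>

definition area_measure :: "'a flat_surface \<Rightarrow> 'a measure" where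
  "area_measure S = (SUP (U, f)\<in>atlas S. chart_measure (surf S) U f)"

definition vol :: "'a flat_surface \<Rightarrow> ennreal" where
  "vol S = emeasure (area_measure S) (topspace (surf S))"

text \<open>The geodesic is parametrised with constant velocity \<open>v\<close> over the unit interval, so that \<open>v\<close> is
  its vector in local coordinates.\<close>

definition saddle_connection :: "'a flat_surface \<Rightarrow> (real \<Rightarrow> 'a) \<Rightarrow> complex \<Rightarrow> bool" where
  "saddle_connection S \<gamma> v \<longleftrightarrow>
     v \<noteq> 0 \<and> pathin (surf S) \<gamma> \<and> \<gamma> 0 \<in> sing S \<and> \<gamma> 1 \<in> sing S \<and>
     (\<forall>t\<in>{0<..<1}. \<gamma> t \<notin> sing S) \<and>
     (\<forall>(U, f)\<in>atlas S. \<forall>t\<in>{0<..<1}. \<gamma> t \<in> U \<longrightarrow>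
        (\<forall>\<^sub>F s in nhds t. f (\<gamma> s) = f (\<gamma> t) + (s - t) *\<^sub>R v))"

definition V_sc :: "'a flat_surface \<Rightarrow> complex set" where
  "V_sc S = {v. \<exists>\<gamma>. saddle_connection S \<gamma> v}"

text \<open>The completed measure is needed because a convex set is Lebesgue measurable but not
  necessarily Borel.\<close>

definition minkowski_constant :: "complex set \<Rightarrow> ennreal" where
  "minkowski_constant Z =
     (SUP C\<in>{C. bounded C \<and> convex C \<and> (\<forall>x\<in>C. - x \<in> C) \<and> C \<inter> Z = {}}. emeasure lebesgue C) / 4"

end

(* Let p be a singularity. Every convex set C that is symmetric and avoids the saddle connection
   vectors satisfies area (C / 2) <= vol S, which is stronger than needed by the factor pi.
   A geodesic issuing from p in the direction v can only be stopped by a singularity, and this gives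
   a saddle connection vector on the segment [0, v]. Hence the exponential map of p is defined on C.
   It is injective on C / 2: if x and y have the same image q, follow from q the geodesic with
   velocity -x. Seen from x it runs back into p at time 1, whereas seen from y it is the image of the
   segment from y to y - x, which lies in C and is thus mapped to nonsingular points.
   Since the exponential map preserves area, area (C / 2) <= vol S.
   The total angle at p may exceed 2 pi, so the exponential map is studied in logarithmic polar
   coordinates: z stands for the vector exp z, and radial lines become horizontal ones. *)
theory Submission
  imports Defs
begin

subsection \<open>Planar charts\<close>

lemma planar_chart_inj:
  assumes "planar_chart X U f"
  shows "inj_on f U"
proof -
  have "topspace (subtopology X U) = U"
    using assms openin_subset by (fastforce simp: planar_chart_def)
  then show ?thesis
    using assms homeomorphic_imp_injective_map unfolding planar_chart_def by metis
qed

lemma planar_chart_openin: "planar_chart X U f \<Longrightarrow> openin X U"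
  by (simp add: planar_chart_def)

lemma planar_chart_openin_vimage:
  assumes "planar_chart X U f" "open B"
  shows "openin X {q \<in> U. f q \<in> B}"
proof -
  have U: "openin X U" and "continuous_map (subtopology X U) (top_of_set (f ` U)) f"
    using assms(1) by (auto simp: planar_chart_def homeomorphic_imp_continuous_map)
  then have "continuous_map (subtopology X U) euclidean f"
    by (simp add: continuous_map_in_subtopology)
  then have "openin (subtopology X U) {q \<in> topspace (subtopology X U). f q \<in> B}"
    using assms(2) by (intro openin_continuous_map_preimage) auto
  moreover have "topspace (subtopology X U) = U"
    using U openin_subset by fastforce
  ultimately have "openin (subtopology X U) {q \<in> U. f q \<in> B}"
    by (simp only:)
  then show ?thesis
    using U by (simp add: openin_open_subtopology)
qed

lemma planar_chart_open_image:
  assumes "planar_chart X U f" "openin X V"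
  shows "open (f ` (U \<inter> V))"
proof -
  have U: "openin X U" and o: "open (f ` U)"
    and "open_map (subtopology X U) (top_of_set (f ` U)) f"
    using assms(1) by (auto simp: planar_chart_def homeomorphic_imp_open_map)
  moreover have "openin (subtopology X U) (U \<inter> V)"
    using U assms(2) by (simp add: openin_open_subtopology openin_Int)
  ultimately have "openin (top_of_set (f ` U)) (f ` (U \<inter> V))"
    by (simp add: open_map_def)
  with o show ?thesis
    using openin_open_trans by blast
qed

text \<open>Closeness in coordinates is turned into closeness on the surface: the image of
  \<open>U \<inter> V\<close> under the chart is open, and injectivity leaves each of its points
  only one preimage in \<open>U\<close>.\<close>

lemma planar_chart_eventually:
  assumes "planar_chart X U f" "openin X V" "q \<in> U" "q \<in> V"
  shows "\<forall>\<^sub>F w in nhds (f q). w \<in> f ` U \<and> (\<forall>q'\<in>U. f q' = w \<longrightarrow> q' \<in> V)"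
proof -
  have "open (f ` (U \<inter> V))" "f q \<in> f ` (U \<inter> V)"
    using planar_chart_open_image[OF assms(1,2)] assms(3,4) by auto
  moreover have "w \<in> f ` U \<and> (\<forall>q'\<in>U. f q' = w \<longrightarrow> q' \<in> V)" if "w \<in> f ` (U \<inter> V)" for w
    using that planar_chart_inj[OF assms(1)] by (auto simp: inj_on_def)
  ultimately show ?thesis
    by (subst eventually_nhds) blast
qed

section \<open>Neighbourhoods, compactness and paths\<close>

lemma continuous_on_eventually_nhds:
  assumes "continuous_on B u" "b \<in> B" "\<forall>\<^sub>F a in nhds (u b). P a"
  shows "\<forall>\<^sub>F b' in nhds b. b' \<in> B \<longrightarrow> P (u b')"
proof -
  obtain N where "open N" "u b \<in> N" "\<And>a. a \<in> N \<Longrightarrow> P a"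
    using assms(3) by (auto simp: eventually_nhds)
  moreover from this obtain A where "open A" "b \<in> A" "\<forall>y\<in>B. y \<in> A \<longrightarrow> u y \<in> N"
    using assms(1,2) unfolding continuous_on_topological by metis
  ultimately show ?thesis
    by (subst eventually_nhds) blast
qed

text \<open>Finitely many of the sets \<open>V\<close> cover \<open>K\<close>, and finitely many
  eventual statements hold simultaneously.\<close>

lemma compactin_eventually_notin:
  assumes "compactin X K" "\<And>m. m \<in> K \<Longrightarrow> \<exists>V. openin X V \<and> m \<in> V \<and> (\<forall>\<^sub>F t in F. g t \<notin> V)"
  shows "\<forall>\<^sub>F t in F. g t \<notin> K"
proof -
  have "\<forall>m\<in>K. \<exists>V. openin X V \<and> m \<in> V \<and> (\<forall>\<^sub>F t in F. g t \<notin> V)"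
    using assms(2) by blast
  from bchoice[OF this] obtain V
    where V: "\<forall>m\<in>K. openin X (V m) \<and> m \<in> V m \<and> (\<forall>\<^sub>F t in F. g t \<notin> V m)" ..
  have "\<forall>U\<in>V ` K. openin X U" "K \<subseteq> \<Union> (V ` K)"
    using V by blast+
  then obtain \<F> where "finite \<F>" "\<F> \<subseteq> V ` K" "K \<subseteq> \<Union> \<F>"
    using assms(1) unfolding compactin_def by meson
  then obtain I where I: "finite I" "I \<subseteq> K" "K \<subseteq> \<Union> (V ` I)"
    by (metis finite_subset_image)
  have "\<forall>\<^sub>F t in F. \<forall>m\<in>I. g t \<notin> V m"
    using I V by (intro eventually_ball_finite) auto
  then show ?thesis
    by (rule eventually_mono) (use I in blast)
qed

text \<open>Pointwise test for continuity on the closed unit interval; it suits a path that is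
  defined by cases at its two end points.\<close>

lemma pathinI:
  assumes "\<And>x V. x \<in> {0..1} \<Longrightarrow> openin X V \<Longrightarrow> g x \<in> V \<Longrightarrow> \<forall>\<^sub>F t in nhds x. t \<in> {0..1} \<longrightarrow> g t \<in> V"
    and "\<And>x. x \<in> {0..1} \<Longrightarrow> g x \<in> topspace X"
  shows "pathin X g"
  unfolding pathin_def continuous_map_def
proof (intro conjI allI impI)
  show "g \<in> topspace (top_of_set {0..1}) \<rightarrow> topspace X"
    using assms(2) by auto
next
  fix V assume V: "openin X V"
  show "openin (top_of_set {0..1}) {x \<in> topspace (top_of_set {0..1}). g x \<in> V}"
  proof (subst openin_subopen, intro ballI)
    fix x assume "x \<in> {x \<in> topspace (top_of_set {0..1}). g x \<in> V}"
    then have x: "x \<in> {0..1}" "g x \<in> V" by auto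
    obtain N where "open N" "x \<in> N" "\<And>t. t \<in> N \<Longrightarrow> t \<in> {0..1} \<Longrightarrow> g t \<in> V"
      using assms(1)[OF x(1) V x(2)] by (auto simp: eventually_nhds)
    then show "\<exists>T. openin (top_of_set {0..1}) T \<and> x \<in> T \<and> T \<subseteq> {x \<in> topspace (top_of_set {0..1}). g x \<in> V}"
      using x by (intro exI[of _ "{0..1} \<inter> N"]) auto
  qed
qed

lemma limitin_at_leftD:
  fixes b :: real
  assumes "limitin X g l (at_left b)" "openin X V" "l \<in> V"
  obtains c where "c < b" "\<And>t. c < t \<Longrightarrow> t < b \<Longrightarrow> g t \<in> V"
proof -
  have "\<forall>\<^sub>F t in at_left b. g t \<in> V"
    using assms by (simp add: limitin_def)
  then show ?thesis
    using that unfolding eventually_at_left_field by blast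
qed

text \<open>Boxes replace discs because real and imaginary part have separate roles in logarithmic
  polar coordinates: logarithm of the distance and angle.\<close>

lemma exp_box:
  assumes "0 < e"
  obtains d where "0 < d" "\<And>z. \<bar>Re z - a\<bar> < d \<Longrightarrow> \<bar>Im z - b\<bar> < d \<Longrightarrow> dist (exp z) (exp (Complex a b)) < (e::real)"
proof -
  have "isCont exp (Complex a b)"
    by (intro continuous_intros)
  then obtain d where d: "0 < d" "\<And>z. dist z (Complex a b) < d \<Longrightarrow> dist (exp z) (exp (Complex a b)) < e"
    using assms unfolding continuous_at_eps_delta by blast
  have "dist (exp z) (exp (Complex a b)) < e" if "\<bar>Re z - a\<bar> < d / 2" "\<bar>Im z - b\<bar> < d / 2" for z
  proof (rule d(2))
    show "dist z (Complex a b) < d"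
      using cmod_le[of "z - Complex a b"] that by (simp add: dist_norm)
  qed
  then show ?thesis
    using d(1) that[of "d / 2"] by simp
qed

lemma eventually_nhds_box:
  assumes "\<forall>\<^sub>F z in nhds (Complex a b). P z"
  obtains d where "0 < d" "\<And>z. \<bar>Re z - a\<bar> < d \<Longrightarrow> \<bar>Im z - b\<bar> < d \<Longrightarrow> P z"
proof -
  obtain d where d: "0 < d" "\<And>z. dist z (Complex a b) < d \<Longrightarrow> P z"
    using assms unfolding eventually_nhds_metric by auto
  have "P z" if "\<bar>Re z - a\<bar> < d / 2" "\<bar>Im z - b\<bar> < d / 2" for z
  proof (rule d(2))
    show "dist z (Complex a b) < d"
      using cmod_le[of "z - Complex a b"] that by (simp add: dist_norm)
  qed
  then show ?thesis
    using d(1) that[of "d / 2"] by simp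
qed

subsection \<open>Maps with prescribed local coordinates\<close>

text \<open>For \<open>\<phi> t = t v\<close> on an interval these are the geodesics of velocity \<open>v\<close>.\<close>

definition develops ::
    "'a flat_surface \<Rightarrow> ('b::topological_space \<Rightarrow> complex) \<Rightarrow> 'b set \<Rightarrow> ('b \<Rightarrow> 'a) \<Rightarrow> bool" where
  "develops S \<phi> A G \<longleftrightarrow>
     (\<forall>a\<in>A. G a \<in> topspace (surf S) - sing S \<and>
        (\<forall>(U, f)\<in>atlas S. G a \<in> U \<longrightarrow>
           (\<forall>\<^sub>F b in nhds a. b \<in> A \<longrightarrow> G b \<in> U \<and> f (G b) = f (G a) + (\<phi> b - \<phi> a))))"

lemma developsD:
  assumes "develops S \<phi> A G" "a \<in> A"
  shows "G a \<in> topspace (surf S)" "G a \<notin> sing S"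
    and "(U, f) \<in> atlas S \<Longrightarrow> G a \<in> U \<Longrightarrow>
      \<forall>\<^sub>F b in nhds a. b \<in> A \<longrightarrow> G b \<in> U \<and> f (G b) = f (G a) + (\<phi> b - \<phi> a)"
  using assms unfolding develops_def by fast+

text \<open>With \<open>\<phi> = exp\<close> and a curve \<open>u\<close> in the logarithmic plane,
  this turns the exponential map into a curve on the surface whose coordinates are
  \<open>exp (u b)\<close> up to translation.\<close>

lemma develops_compose:
  assumes "develops S \<phi> A G" "continuous_on B u" "u ` B \<subseteq> A"
  shows "develops S (\<lambda>b. \<phi> (u b)) B (\<lambda>b. G (u b))"
  unfolding develops_def
proof (intro ballI conjI, goal_cases)
  case (1 b)
  then show ?case
    using developsD(1,2)[OF assms(1)] assms(3) by auto
next
  case (2 b c)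
  obtain U f where c: "c = (U, f)" by force
  have "\<forall>\<^sub>F b' in nhds b. b' \<in> B \<longrightarrow>
      (u b' \<in> A \<longrightarrow> G (u b') \<in> U \<and> f (G (u b')) = f (G (u b)) + (\<phi> (u b') - \<phi> (u b)))"
    if "G (u b) \<in> U"
    using developsD(3)[OF assms(1)] assms(3) 2 c that
    by (intro continuous_on_eventually_nhds[OF assms(2)]) auto
  then show ?case
    using c assms(3) by (auto simp: image_subset_iff elim: eventually_mono)
qed

text \<open>Only differences of values of \<open>\<phi>\<close> enter \<open>develops\<close>, so
  the constant \<open>c\<close> is harmless.\<close>

lemma develops_cong:
  assumes "develops S \<psi> A H" "\<And>a. a \<in> A \<Longrightarrow> \<phi> a = \<psi> a + c" "\<And>a. a \<in> A \<Longrightarrow> G a = H a"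
  shows "develops S \<phi> A G"
  unfolding develops_def
proof (intro ballI conjI, goal_cases)
  case (1 a)
  then show ?case
    using developsD(1,2)[OF assms(1)] assms(3) by auto
next
  case (2 a x)
  obtain U f where x: "x = (U, f)" by force
  have "\<forall>\<^sub>F b in nhds a. b \<in> A \<longrightarrow> G b \<in> U \<and> f (G b) = f (G a) + (\<phi> b - \<phi> a)" if "G a \<in> U"
    using developsD(3)[OF assms(1) 2(1), of U f]
    by (rule eventually_mono[rotated 2]) (use 2 x that assms(2,3) in auto)
  then show ?case
    using x by auto
qed

lemma develops_localI:
  assumes "\<And>a. a \<in> A \<Longrightarrow> \<exists>N. open N \<and> a \<in> N \<and> develops S \<phi> (A \<inter> N) G"
  shows "develops S \<phi> A G"
  unfolding develops_def
proof (intro ballI conjI, goal_cases)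
  case (1 a)
  then show ?case
    using assms[of a] developsD(1,2) by (metis DiffI IntI)
next
  case (2 a c)
  obtain U f where c: "c = (U, f)" by force
  obtain N where N: "open N" "a \<in> N" "develops S \<phi> (A \<inter> N) G"
    using assms 2 by blast
  have "\<forall>\<^sub>F b in nhds a. b \<in> A \<longrightarrow> G b \<in> U \<and> f (G b) = f (G a) + (\<phi> b - \<phi> a)" if "G a \<in> U"
  proof -
    have "\<forall>\<^sub>F b in nhds a. b \<in> A \<inter> N \<longrightarrow> G b \<in> U \<and> f (G b) = f (G a) + (\<phi> b - \<phi> a)"
      using developsD(3)[OF N(3)] N(2) 2 c that by auto
    moreover have "\<forall>\<^sub>F b in nhds a. b \<in> N"
      using N by (simp add: eventually_nhds_in_open)
    ultimately show ?thesis
      by eventually_elim auto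
  qed
  then show ?case
    using c by auto
qed

lemma develops_subset: "develops S \<phi> A G \<Longrightarrow> B \<subseteq> A \<Longrightarrow> develops S \<phi> B G"
  using develops_compose[of S \<phi> A G B "\<lambda>x. x"] by auto

section \<open>Developed maps on a compact translation surface\<close>

locale translation_surface =
  fixes S :: "'a flat_surface"
  assumes compact_translation_surface: "compact_translation_surface S"
begin

abbreviation X where "X \<equiv> surf S"

lemma Hausdorff: "Hausdorff_space X" and compact: "compact_space X" and finite_sing: "finite (sing S)"
  and sing_subset: "sing S \<subseteq> topspace X"
  and chart_union: "(\<Union>(U, f)\<in>atlas S. U) = topspace X - sing S"
  and charts: "\<forall>(U, f)\<in>atlas S. planar_chart X U f"
  and transitions: "\<forall>(U, f)\<in>atlas S. \<forall>(V, g)\<in>atlas S. locally_translates X (U \<inter> V) f g"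
  and cone_points: "\<forall>p\<in>sing S. cone_point S p"
  using compact_translation_surface unfolding compact_translation_surface_def by blast+

lemma chart: "(U, f) \<in> atlas S \<Longrightarrow> planar_chart X U f"
  using charts by blast

lemma chart_subset: "(U, f) \<in> atlas S \<Longrightarrow> U \<subseteq> topspace X - sing S"
  unfolding chart_union[symmetric] by blast

lemma chart_exists:
  assumes "q \<in> topspace X - sing S"
  obtains U f where "(U, f) \<in> atlas S" "q \<in> U"
proof -
  have "q \<in> (\<Union>(U, f)\<in>atlas S. U)"
    using assms unfolding chart_union .
  then show ?thesis
    using that by blast
qed

lemma transition:
  assumes "(U, f) \<in> atlas S" "(V, g) \<in> atlas S" "q \<in> U" "q \<in> V"
  obtains N c where "openin X N" "q \<in> N" "\<And>q'. q' \<in> N \<Longrightarrow> q' \<in> U \<Longrightarrow> q' \<in> V \<Longrightarrow> g q' = f q' + c"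
proof -
  have "locally_translates X (U \<inter> V) f g"
    using assms(1,2) transitions by blast
  then obtain N c where "openin X N" "q \<in> N" "\<forall>q'\<in>N \<inter> (U \<inter> V). f q' = g q' + c"
    using assms(3,4) unfolding locally_translates_def by (meson IntI)
  \<comment> \<open>\<open>locally_translates\<close> expresses \<open>f\<close> by
    \<open>g\<close>, hence the sign.\<close>
  then show ?thesis
    using that[of N "- c"] by force
qed

text \<open>Continuity of \<open>G\<close> is not built into \<open>develops\<close>. It comes from
  the coordinate formula in one chart, because \<open>\<phi>\<close> is continuous and nearby
  coordinates in \<open>U\<close> belong to nearby points.\<close>

lemma eventually_chart_nbhd:
  assumes "(U, f) \<in> atlas S" "G a \<in> U" "openin X V" "G a \<in> V" "continuous_on A \<phi>" "a \<in> A"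
    and "\<forall>\<^sub>F b in nhds a. b \<in> A \<longrightarrow> G b \<in> U \<and> f (G b) = f (G a) + (\<phi> b - \<phi> a)"
  shows "\<forall>\<^sub>F b in nhds a. b \<in> A \<longrightarrow> G b \<in> V"
proof -
  have "continuous_on A (\<lambda>b. f (G a) + (\<phi> b - \<phi> a))"
    by (intro continuous_intros assms)
  moreover have "\<forall>\<^sub>F w in nhds (f (G a) + (\<phi> a - \<phi> a)). \<forall>q'\<in>U. f q' = w \<longrightarrow> q' \<in> V"
    unfolding diff_self add_0_right
    by (rule eventually_mono[OF planar_chart_eventually[OF chart[OF assms(1)] assms(3,2,4)]]) blast
  ultimately have "\<forall>\<^sub>F b in nhds a. b \<in> A \<longrightarrow> (\<forall>q'\<in>U. f q' = f (G a) + (\<phi> b - \<phi> a) \<longrightarrow> q' \<in> V)"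
    by (rule continuous_on_eventually_nhds[OF _ assms(6)])
  with assms(7) show ?thesis
    by eventually_elim auto
qed

lemma develops_eventually:
  assumes "develops S \<phi> A G" "continuous_on A \<phi>" "a \<in> A" "openin X V" "G a \<in> V"
  shows "\<forall>\<^sub>F b in nhds a. b \<in> A \<longrightarrow> G b \<in> V"
proof -
  obtain U f where U: "(U, f) \<in> atlas S" "G a \<in> U"
    using chart_exists developsD(1,2)[OF assms(1,3)] by blast
  show ?thesis
    by (rule eventually_chart_nbhd[where \<phi> = \<phi>, OF U assms(4,5,2,3) developsD(3)[OF assms(1,3) U]])
qed

text \<open>One chart at each point suffices. Near \<open>G a\<close> the transition to another
  chart is a translation, and by \<open>eventually_chart_nbhd\<close> the points \<open>G b\<close>
  stay where it is valid; the translation vector cancels in the difference.\<close>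

lemma developsI:
  assumes "continuous_on A \<phi>"
    and "\<And>a. a \<in> A \<Longrightarrow> \<exists>U f. (U, f) \<in> atlas S \<and> G a \<in> U \<and>
      (\<forall>\<^sub>F b in nhds a. b \<in> A \<longrightarrow> G b \<in> U \<and> f (G b) = f (G a) + (\<phi> b - \<phi> a))"
  shows "develops S \<phi> A G"
  unfolding develops_def
proof (intro ballI conjI, goal_cases)
  case (1 a)
  then show ?case
    using assms(2) chart_subset by blast
next
  case (2 a c)
  obtain V g where c: "c = (V, g)" by force
  have "\<forall>\<^sub>F b in nhds a. b \<in> A \<longrightarrow> G b \<in> V \<and> g (G b) = g (G a) + (\<phi> b - \<phi> a)" if V: "G a \<in> V"
  proof -
    obtain U f where U: "(U, f) \<in> atlas S" "G a \<in> U"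
      and ev: "\<forall>\<^sub>F b in nhds a. b \<in> A \<longrightarrow> G b \<in> U \<and> f (G b) = f (G a) + (\<phi> b - \<phi> a)"
      using assms(2) 2 by blast
    obtain N c' where N: "openin X N" "G a \<in> N"
      "\<And>q'. q' \<in> N \<Longrightarrow> q' \<in> U \<Longrightarrow> q' \<in> V \<Longrightarrow> g q' = f q' + c'"
      using transition[OF U(1) _ U(2) V] 2 c by metis
    have "openin X (N \<inter> V)"
      using N(1) planar_chart_openin[OF chart] 2(2) c by auto
    then have "\<forall>\<^sub>F b in nhds a. b \<in> A \<longrightarrow> G b \<in> N \<inter> V"
      by (rule eventually_chart_nbhd[where \<phi> = \<phi>, OF U _ _ assms(1) 2(1) ev]) (use N V in auto)
    with ev show ?thesis
      by eventually_elim (use N U V in auto)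
  qed
  then show ?case
    using c by auto
qed

lemma develops_inv_chart:
  assumes "(U, f) \<in> atlas S" "continuous_on A \<phi>" "\<And>a. a \<in> A \<Longrightarrow> \<phi> a + c \<in> f ` U"
  shows "develops S \<phi> A (\<lambda>a. inv_into U f (\<phi> a + c))"
proof (rule developsI[OF assms(2)])
  fix a assume "a \<in> A"
  then show "\<exists>V g. (V, g) \<in> atlas S \<and> inv_into U f (\<phi> a + c) \<in> V \<and>
      (\<forall>\<^sub>F b in nhds a. b \<in> A \<longrightarrow> inv_into U f (\<phi> b + c) \<in> V \<and>
        g (inv_into U f (\<phi> b + c)) = g (inv_into U f (\<phi> a + c)) + (\<phi> b - \<phi> a))"
    using assms by (intro exI[of _ U] exI[of _ f]) (auto simp: inv_into_into f_inv_into_f)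
qed

text \<open>Identity principle: agreement is an open condition because charts are injective,
  disagreement because the surface is Hausdorff, and \<open>A\<close> is connected.\<close>

lemma develops_unique:
  assumes "connected A" "develops S \<phi> A G" "develops S \<psi> A H" "continuous_on A \<phi>" "continuous_on A \<psi>"
    and "\<And>a. a \<in> A \<Longrightarrow> \<phi> a = \<psi> a + c" "a \<in> A" "G a = H a" "b \<in> A"
  shows "G b = H b"
proof (rule connected_induction_simple[where P = "\<lambda>a. G a = H a" and S = A and a = a])
  fix x assume x: "x \<in> A"
  have "\<exists>v. \<forall>\<^sub>F y in nhds x. y \<in> A \<longrightarrow> (G y = H y) = v"
  proof (cases "G x = H x")
    case True
    obtain U f where U: "(U, f) \<in> atlas S" "G x \<in> U"
      using chart_exists developsD(1,2)[OF assms(2) x] by blast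
    have "\<forall>\<^sub>F y in nhds x. y \<in> A \<longrightarrow> G y \<in> U \<and> f (G y) = f (G x) + (\<phi> y - \<phi> x)"
      "\<forall>\<^sub>F y in nhds x. y \<in> A \<longrightarrow> H y \<in> U \<and> f (H y) = f (H x) + (\<psi> y - \<psi> x)"
      using U True developsD(3)[OF assms(2) x U(1)] developsD(3)[OF assms(3) x U(1)] by auto
    then have "\<forall>\<^sub>F y in nhds x. y \<in> A \<longrightarrow> G y = H y"
    proof eventually_elim
      case (elim y)
      have "G y = H y" if "y \<in> A"
        using elim that True planar_chart_inj[OF chart[OF U(1)]] assms(6)[OF x] assms(6)[OF that]
        by (auto simp: inj_on_def)
      then show ?case by blast
    qed
    then show ?thesis
      by (intro exI[of _ True]) simp
  next
    case False
    then obtain V W where "openin X V" "openin X W" "G x \<in> V" "H x \<in> W" "disjnt V W"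
      using Hausdorff developsD(1)[OF assms(2) x] developsD(1)[OF assms(3) x]
      unfolding Hausdorff_space_def by metis
    then have "\<forall>\<^sub>F y in nhds x. y \<in> A \<longrightarrow> G y \<in> V" "\<forall>\<^sub>F y in nhds x. y \<in> A \<longrightarrow> H y \<in> W"
      using develops_eventually assms(2-5) x by metis+
    then have "\<forall>\<^sub>F y in nhds x. y \<in> A \<longrightarrow> (G y = H y) = False"
      by eventually_elim (use \<open>disjnt V W\<close> in \<open>auto simp: disjnt_iff\<close>)
    then show ?thesis by blast
  qed
  then obtain v N where "open N" "x \<in> N" "\<And>y. y \<in> N \<Longrightarrow> y \<in> A \<Longrightarrow> (G y = H y) = v"
    by (auto simp: eventually_nhds)
  then show "\<exists>T. openin (top_of_set A) T \<and> x \<in> T \<and> (\<forall>x\<in>T. \<forall>y\<in>T. G x = H x \<longrightarrow> G y = H y)"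
    using x by (intro exI[of _ "A \<inter> N"]) auto
qed (use assms in auto)

text \<open>Compactness yields a cluster point, which \<open>escape\<close> forces to be singular.
  As there are finitely many singularities, it can be separated from the others; on a connected
  interval the curve cannot change sides, so the cluster point is a limit.\<close>

lemma develops_limit_singular:
  fixes b :: real
  assumes dev: "develops S \<phi> {..<b} g" and cont: "continuous_on {..<b} \<phi>"
    and escape: "\<And>m. m \<in> topspace X \<Longrightarrow> m \<notin> sing S \<Longrightarrow>
      \<exists>V. openin X V \<and> m \<in> V \<and> (\<forall>\<^sub>F t in at_left b. g t \<notin> V)"
  obtains s where "s \<in> sing S" "limitin X g s (at_left b)"
proof -
  have left: "\<forall>\<^sub>F t in at_left b. t < b"
    by (simp add: eventually_at_filter)
  have gX: "g t \<in> topspace X" if "t < b" for t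
    using developsD(1)[OF dev, of t] that by simp
  have "\<exists>s\<in>sing S. \<forall>V. openin X V \<longrightarrow> s \<in> V \<longrightarrow> (\<exists>\<^sub>F t in at_left b. g t \<in> V)"
  proof (rule ccontr)
    assume no: "\<not> ?thesis"
    have *: "\<exists>V. openin X V \<and> m \<in> V \<and> (\<forall>\<^sub>F t in at_left b. g t \<notin> V)" if "m \<in> topspace X" for m
    proof (cases "m \<in> sing S")
      case True
      with no show ?thesis
        unfolding not_frequently[symmetric] by blast
    qed (rule escape[OF that])
    \<comment> \<open>By compactness the curve would eventually avoid the whole surface.\<close>
    have "\<forall>\<^sub>F t in at_left b. g t \<notin> topspace X"
      by (rule compactin_eventually_notin[OF _ *]) (use compact in \<open>auto simp: compact_space_def\<close>)
    with left have "\<forall>\<^sub>F t in at_left b. False"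
      by eventually_elim (use gX in blast)
    then show False by simp
  qed
  then obtain s where s: "s \<in> sing S"
    and freq: "\<And>V. openin X V \<Longrightarrow> s \<in> V \<Longrightarrow> \<exists>\<^sub>F t in at_left b. g t \<in> V"
    by blast
  have "compactin X {s}" "compactin X (sing S - {s})"
    using s sing_subset finite_sing by (auto intro!: finite_imp_compactin)
  then obtain A B where AB: "openin X A" "openin X B" "s \<in> A" "sing S - {s} \<subseteq> B" "disjnt A B"
    using Hausdorff Hausdorff_space_compact_sets[of X] by (metis Diff_disjoint disjnt_def insert_subset)
  have "\<forall>\<^sub>F t in at_left b. g t \<in> N" if N: "openin X N" "s \<in> N" for N
  proof -
    define A' where "A' = A \<inter> N"
    have A': "openin X A'" "s \<in> A'" "disjnt A' B" "A' \<subseteq> N"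
      using AB N by (auto simp: A'_def disjnt_def)
    \<comment> \<open>All points outside \<open>A'\<close> and \<open>B\<close> are regular, so the
      curve eventually avoids this compact set.\<close>
    have "compactin X (topspace X - (A' \<union> B))"
      using A' AB compact by (intro closedin_compact_space) auto
    then have "\<forall>\<^sub>F t in at_left b. g t \<notin> topspace X - (A' \<union> B)"
      by (rule compactin_eventually_notin) (use escape A' AB in blast)
    with left have "\<forall>\<^sub>F t in at_left b. g t \<in> A' \<union> B"
      by eventually_elim (use gX in auto)
    then obtain c where c: "c < b" "\<And>t. c < t \<Longrightarrow> t < b \<Longrightarrow> g t \<in> A' \<union> B"
      unfolding eventually_at_left_field by blast
    have "\<forall>\<^sub>F t in at_left b. c < t \<and> t < b"
      using c(1) unfolding eventually_at_left_field by blast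
    from frequently_eventually_frequently[OF freq[OF A'(1,2)] this]
    obtain t0 where t0: "g t0 \<in> A'" "c < t0" "t0 < b"
      using frequently_ex by blast
    \<comment> \<open>\<open>A'\<close> and \<open>B\<close> are disjoint and open, so membership in
      \<open>A'\<close> is locally constant along the curve after \<open>c\<close>, and it holds at
      \<open>t0\<close>.\<close>
    have "g t \<in> A'" if t: "c < t" "t < b" for t
    proof (rule connected_induction_simple[where P = "\<lambda>t. g t \<in> A'" and S = "{c<..<b}" and a = t0])
      fix x assume x: "x \<in> {c<..<b}"
      have "\<exists>v. \<forall>\<^sub>F y in nhds x. y \<in> {..<b} \<longrightarrow> y \<in> {c<..<b} \<longrightarrow> (g y \<in> A') = v"
      proof (cases "g x \<in> A'")
        case True
        then have "\<forall>\<^sub>F y in nhds x. y \<in> {..<b} \<longrightarrow> g y \<in> A'"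
          using develops_eventually[OF dev cont _ A'(1)] x by simp
        then show ?thesis
          by (intro exI[of _ True]) (auto elim: eventually_mono)
      next
        case False
        then have "g x \<in> B" using c(2)[of x] x by auto
        then have "\<forall>\<^sub>F y in nhds x. y \<in> {..<b} \<longrightarrow> g y \<in> B"
          using develops_eventually[OF dev cont _ AB(2)] x by simp
        then show ?thesis
          using A'(3) by (intro exI[of _ False]) (auto elim!: eventually_mono simp: disjnt_iff)
      qed
      then obtain v N where "open N" "x \<in> N" "\<And>y. y \<in> N \<Longrightarrow> y \<in> {c<..<b} \<Longrightarrow> (g y \<in> A') = v"
        by (auto simp: eventually_nhds)
      then show "\<exists>T. openin (top_of_set {c<..<b}) T \<and> x \<in> T \<and> (\<forall>x\<in>T. \<forall>y\<in>T. g x \<in> A' \<longrightarrow> g y \<in> A')"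
        using x by (intro exI[of _ "{c<..<b} \<inter> N"]) auto
    qed (use t t0 in auto)
    then show ?thesis
      using c(1) A'(4) unfolding eventually_at_left_field by blast
  qed
  then have "limitin X g s (at_left b)"
    using s sing_subset by (auto simp: limitin_def)
  with s that show ?thesis by blast
qed

end

subsection \<open>The exponential map of a singularity\<close>

locale cone_chart = translation_surface S for S :: "'a flat_surface" +
  fixes p :: 'a and k :: nat and D :: "'a set" and h :: "'a \<Rightarrow> complex" and r :: real
  assumes k: "k \<ge> 1" and r: "r > 0" and p: "p \<in> D" and D_sing: "D \<inter> sing S = {p}"
    and h: "planar_chart X D h" and h_image: "h ` D = ball 0 r" and h_p: "h p = 0"
    and pullback: "\<forall>(V, f)\<in>atlas S. locally_translates X (D \<inter> V) f (\<lambda>q. h q ^ k)"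
begin

text \<open>The flat coordinate around \<open>p\<close> is \<open>h ^ k\<close> up to translation,
  so the vector \<open>exp z\<close> is reached where \<open>h\<close> equals
  \<open>exp (z / k)\<close>. As a function of \<open>Im z\<close> this has period
  \<open>2 * pi * k\<close>, the total angle at \<open>p\<close>. The value is meaningful for
  \<open>Re z < k * ln r\<close>.\<close>

definition cone_exp :: "complex \<Rightarrow> 'a" where
  "cone_exp z = inv_into D h (exp (z / of_nat k))"

lemma p_sing: "p \<in> sing S"
  using D_sing by blast

lemma h_cone_exp:
  assumes "Re z < k * ln r"
  shows "cone_exp z \<in> D" "h (cone_exp z) = exp (z / of_nat k)" "cone_exp z \<in> topspace X - sing S"
proof -
  have "Re z / k < ln r"
    using assms k by (simp add: pos_divide_less_eq mult.commute)
  then have "exp (Re z / k) < r"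
    using r by (metis exp_less_cancel_iff exp_ln)
  then have *: "exp (z / of_nat k) \<in> h ` D"
    by (simp add: h_image)
  show 1: "cone_exp z \<in> D" "h (cone_exp z) = exp (z / of_nat k)"
    unfolding cone_exp_def using * by (rule inv_into_into f_inv_into_f)+
  then have "cone_exp z \<noteq> p"
    using h_p by auto
  then show "cone_exp z \<in> topspace X - sing S"
    using 1(1) D_sing openin_subset[OF planar_chart_openin[OF h]] by blast
qed

lemma cone_exp_eventually:
  assumes "openin X V" "cone_exp a \<in> V" "Re a < k * ln r"
  shows "\<forall>\<^sub>F b in nhds a. Re b < k * ln r \<longrightarrow> cone_exp b \<in> V"
proof -
  have "continuous_on UNIV (\<lambda>b. exp (b / of_nat k) :: complex)"
    using k by (intro continuous_intros) auto
  moreover have "\<forall>\<^sub>F w in nhds (exp (a / of_nat k) :: complex). w \<in> h ` D \<and> (\<forall>q\<in>D. h q = w \<longrightarrow> q \<in> V)"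
    using planar_chart_eventually[OF h assms(1) _ assms(2)] h_cone_exp[OF assms(3)] by simp
  ultimately have "\<forall>\<^sub>F b in nhds a. b \<in> UNIV \<longrightarrow>
      (exp (b / of_nat k) \<in> h ` D \<and> (\<forall>q\<in>D. h q = exp (b / of_nat k) \<longrightarrow> q \<in> V))"
    by (rule continuous_on_eventually_nhds[where u = "\<lambda>b. exp (b / of_nat k)" and b = a, OF _ UNIV_I])
  then show ?thesis
    by (rule eventually_mono) (use h_cone_exp in simp)
qed

text \<open>The \<open>k\<close>-th power of \<open>exp (z / k)\<close> is \<open>exp z\<close>, and
  every chart differs from \<open>h ^ k\<close> locally by a translation.\<close>

lemma develops_cone_exp: "develops S exp {z. Re z < k * ln r} cone_exp"
proof (rule developsI)
  fix a :: complex assume "a \<in> {z. Re z < k * ln r}"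
  then have a: "Re a < k * ln r" by simp
  obtain V f where V: "(V, f) \<in> atlas S" "cone_exp a \<in> V"
    using chart_exists h_cone_exp(3)[OF a] by blast
  have "locally_translates X (D \<inter> V) f (\<lambda>q. h q ^ k)"
    using pullback V(1) by blast
  then obtain N c where N: "openin X N" "cone_exp a \<in> N" "\<And>q. q \<in> N \<inter> (D \<inter> V) \<Longrightarrow> f q = h q ^ k + c"
    using V(2) h_cone_exp(1)[OF a] unfolding locally_translates_def by (meson IntI)
  have "openin X (N \<inter> V)"
    using N(1) planar_chart_openin[OF chart[OF V(1)]] by (rule openin_Int)
  then have "\<forall>\<^sub>F b in nhds a. Re b < k * ln r \<longrightarrow> cone_exp b \<in> N \<inter> V"
    by (rule cone_exp_eventually[OF _ _ a]) (use N V in simp)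
  moreover have "f (cone_exp b) = exp b + c" if "Re b < k * ln r" "cone_exp b \<in> N \<inter> V" for b
  proof -
    have "exp (b / of_nat k) ^ k = exp b"
      using k by (subst exp_of_nat_mult[symmetric]) simp
    then show ?thesis
      using N(3)[of "cone_exp b"] that h_cone_exp[OF that(1)] by simp
  qed
  ultimately have "\<forall>\<^sub>F b in nhds a. b \<in> {z. Re z < k * ln r} \<longrightarrow>
      cone_exp b \<in> V \<and> f (cone_exp b) = f (cone_exp a) + (exp b - exp a)"
    using N(2) V(2) a by (auto elim!: eventually_mono)
  with V show "\<exists>U f. (U, f) \<in> atlas S \<and> cone_exp a \<in> U \<and> (\<forall>\<^sub>F b in nhds a.
      b \<in> {z. Re z < k * ln r} \<longrightarrow> cone_exp b \<in> U \<and> f (cone_exp b) = f (cone_exp a) + (exp b - exp a))"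
    by blast
qed (intro continuous_intros)

text \<open>In logarithmic polar coordinates \<open>p\<close> lies at the left end, where
  \<open>Re z\<close> tends to minus infinity.\<close>

lemma cone_exp_limit:
  assumes "openin X V" "p \<in> V"
  obtains T where "\<And>z. Re z < T \<Longrightarrow> cone_exp z \<in> V"
proof -
  have "\<forall>\<^sub>F w in nhds 0. w \<in> h ` D \<and> (\<forall>q\<in>D. h q = w \<longrightarrow> q \<in> V)"
    using planar_chart_eventually[OF h assms(1) p assms(2)] by (simp add: h_p)
  then obtain d where d: "d > 0" "\<And>w q. norm w < d \<Longrightarrow> q \<in> D \<Longrightarrow> h q = w \<Longrightarrow> q \<in> V"
    unfolding eventually_nhds_metric by auto
  have "cone_exp z \<in> V" if z: "Re z < min (k * ln r) (k * ln d)" for z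
  proof -
    have "Re z / k < ln d"
      using z k by (simp add: pos_divide_less_eq mult.commute)
    then have "exp (Re z / k) < d"
      using d(1) by (metis exp_less_cancel_iff exp_ln)
    then show ?thesis
      using d(2)[OF _ h_cone_exp(1,2)] z by simp
  qed
  then show ?thesis using that by blast
qed

text \<open>Germs are compared with \<open>cone_exp\<close> only to the left of \<open>start\<close>, well inside the domain of
  \<open>cone_exp\<close>, so that every extension step takes place to the right of \<open>start\<close>.\<close>

definition start :: real where "start = k * ln r - 1"

text \<open>Closure under moving left is star-shapedness about the origin in logarithmic polar
  coordinates. Thus the leftward ray from any point of \<open>A\<close> reaches the region where
  \<open>G\<close> is prescribed.\<close>

definition ext_germ :: "complex set \<Rightarrow> (complex \<Rightarrow> 'a) \<Rightarrow> bool" where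
  "ext_germ A G \<longleftrightarrow> open A \<and> (\<forall>z\<in>A. \<forall>t\<ge>0. z - of_real t \<in> A) \<and> develops S exp A G \<and>
     (\<forall>z\<in>A. Re z < start \<longrightarrow> G z = cone_exp z)"

definition exp_dom :: "complex set" where "exp_dom = \<Union>{A. \<exists>G. ext_germ A G}"

text \<open>By \<open>ext_germ_unique\<close> the choice of the germ does not affect the value on
  \<open>exp_dom\<close>: it is the end point of the geodesic from \<open>p\<close> with vector
  \<open>exp z\<close>, where the angle \<open>Im z\<close> also selects the sheet at the cone
  point.\<close>

definition geo_exp :: "complex \<Rightarrow> 'a" where
  "geo_exp z = (SOME G. \<exists>A. ext_germ A G \<and> z \<in> A) z"

section \<open>Uniqueness of germs and the maximal exponential map\<close>

lemma ext_germD: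
  assumes "ext_germ A G"
  shows "open A" "z \<in> A \<Longrightarrow> 0 \<le> t \<Longrightarrow> z - of_real t \<in> A" "develops S exp A G"
    "z \<in> A \<Longrightarrow> Re z < start \<Longrightarrow> G z = cone_exp z"
  using assms unfolding ext_germ_def by blast+

text \<open>Both domains contain the ray to the left of \<open>z\<close>. Far to the left both germs
  equal \<open>cone_exp\<close>, and \<open>develops_unique\<close> carries the agreement along the
  ray to \<open>z\<close>.\<close>

lemma ext_germ_unique:
  assumes "ext_germ A G" "ext_germ A' G'" "z \<in> A" "z \<in> A'"
  shows "G z = G' z"
proof -
  define u where "u = (\<lambda>t::real. z + of_real t)"
  have u: "u t \<in> A" "u t \<in> A'" if "t \<le> 0" for t
  proof -
    have "u t = z - of_real (- t)"
      by (simp add: u_def)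
    then show "u t \<in> A" "u t \<in> A'"
      using ext_germD(2)[OF assms(1,3), of "- t"] ext_germD(2)[OF assms(2,4), of "- t"] that
      by simp_all
  qed
  have cu: "continuous_on {..0} u" "continuous_on {..0} (\<lambda>t. exp (u t))"
    unfolding u_def by (intro continuous_intros)+
  have dev: "develops S (\<lambda>t. exp (u t)) {..0} (\<lambda>t. G (u t))"
    "develops S (\<lambda>t. exp (u t)) {..0} (\<lambda>t. G' (u t))"
    by (rule develops_compose[OF ext_germD(3)[OF assms(1)] cu(1)]
        develops_compose[OF ext_germD(3)[OF assms(2)] cu(1)]; use u in auto)+
  define t0 where "t0 = min 0 (start - Re z - 1)"
  have "t0 \<le> 0" "Re (u t0) < start"
    by (auto simp: t0_def u_def)
  then have t0: "t0 \<in> {..0}" "G (u t0) = G' (u t0)"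
    using ext_germD(4)[OF assms(1)] ext_germD(4)[OF assms(2)] u[of t0] by simp_all
  have "G (u 0) = G' (u 0)"
    by (rule develops_unique[OF _ dev cu(2) cu(2) _ t0(1,2), where c = 0]) auto
  then show ?thesis
    by (simp add: u_def)
qed

lemma geo_exp_eq:
  assumes "ext_germ A G" "z \<in> A"
  shows "geo_exp z = G z"
proof -
  have "\<exists>G A. ext_germ A G \<and> z \<in> A"
    using assms by blast
  from someI_ex[OF this] obtain A' where "ext_germ A' (SOME G. \<exists>A. ext_germ A G \<and> z \<in> A)" "z \<in> A'"
    by blast
  then show ?thesis
    unfolding geo_exp_def by (rule ext_germ_unique[OF _ assms(1) _ assms(2)])
qed

lemma exp_dom_open: "open exp_dom"
  unfolding exp_dom_def by (rule open_Union) (auto simp: ext_germ_def)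

lemma exp_dom_left: "z \<in> exp_dom \<Longrightarrow> 0 \<le> t \<Longrightarrow> z - of_real t \<in> exp_dom"
  unfolding exp_dom_def using ext_germD(2) by blast

lemma develops_geo_exp: "develops S exp exp_dom geo_exp"
proof (rule develops_localI)
  fix z assume "z \<in> exp_dom"
  then obtain A G where A: "ext_germ A G" "z \<in> A"
    unfolding exp_dom_def by blast
  have "A \<subseteq> exp_dom"
    using A(1) unfolding exp_dom_def by blast
  moreover have "develops S exp A geo_exp"
    by (rule develops_cong[where c = 0 and \<psi> = exp and H = G])
      (use ext_germD(3)[OF A(1)] geo_exp_eq[OF A(1)] in auto)
  ultimately show "\<exists>N. open N \<and> z \<in> N \<and> develops S exp (exp_dom \<inter> N) geo_exp"
    using A(2) ext_germD(1)[OF A(1)] by (intro exI[of _ A]) (simp add: Int_absorb1)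
qed

lemma geo_exp_start: "z \<in> exp_dom \<Longrightarrow> Re z < start \<Longrightarrow> geo_exp z = cone_exp z"
  unfolding exp_dom_def using geo_exp_eq ext_germD(4) by auto

lemma exp_dom_halfplane:
  assumes "Re z < k * ln r"
  shows "z \<in> exp_dom"
proof -
  have "ext_germ {z. Re z < k * ln r} cone_exp"
    using develops_cone_exp by (simp add: ext_germ_def open_halfspace_Re_lt)
  then show ?thesis
    using assms unfolding exp_dom_def by blast
qed

section \<open>Saddle connections as the only obstruction to extension\<close>

text \<open>If the ray at height \<open>y\<close> clusters at a regular point \<open>m\<close> as it
  approaches \<open>T\<close>, a chart around \<open>m\<close> contains a disc of fixed radius. From
  a point of the ray close to \<open>m\<close> the inverse chart continues the exponential map over
  a box that reaches past \<open>T\<close>.\<close>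

lemma exp_dom_extend:
  assumes T: "k * ln r \<le> T" and below: "\<And>t. t < T \<Longrightarrow> Complex t y \<in> exp_dom"
    and m: "m \<in> topspace X" "m \<notin> sing S"
    and cluster: "\<And>V. openin X V \<Longrightarrow> m \<in> V \<Longrightarrow> \<exists>\<^sub>F t in at_left T. geo_exp (Complex t y) \<in> V"
  shows "Complex T y \<in> exp_dom"
proof -
  obtain U f where U: "(U, f) \<in> atlas S" "m \<in> U"
    by (rule chart_exists[of m]) (use m in auto)
  have "open (f ` U)" "f m \<in> f ` U"
    using chart[OF U(1)] U(2) by (auto simp: planar_chart_def)
  then obtain \<rho> where \<rho>: "0 < \<rho>" "ball (f m) \<rho> \<subseteq> f ` U"
    using openE by blast
  \<comment> \<open>Under \<open>exp\<close> two points of the box are less than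
    \<open>\<rho> / 2\<close> apart. From an initial point within \<open>\<rho> / 2\<close> of
    \<open>f m\<close> the continuation thus stays in the disc of radius
    \<open>\<rho>\<close>.\<close>
  obtain \<eta> where \<eta>: "0 < \<eta>"
    "\<And>z. \<bar>Re z - T\<bar> < \<eta> \<Longrightarrow> \<bar>Im z - y\<bar> < \<eta> \<Longrightarrow> dist (exp z) (exp (Complex T y)) < \<rho> / 4"
    using exp_box[of "\<rho> / 4"] \<rho>(1) by auto
  define V where "V = {q \<in> U. f q \<in> ball (f m) (\<rho> / 2)}"
  have V: "openin X V" "m \<in> V"
    unfolding V_def by (rule planar_chart_openin_vimage[OF chart[OF U(1)] open_ball])
      (use U(2) \<rho>(1) in simp)
  \<comment> \<open>By the bound on \<open>T\<close>, \<open>start\<close> is less than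
    \<open>T\<close>. The joining abscissa \<open>t\<close> is taken beyond \<open>start\<close>, so
    the new germ is unchanged where it is compared with \<open>cone_exp\<close>.\<close>
  have "\<forall>\<^sub>F t in at_left T. max start (T - \<eta>) < t \<and> t < T"
    unfolding eventually_at_left_field using \<eta>(1) T
    by (intro exI[of _ "max start (T - \<eta>)"]) (auto simp: start_def)
  from frequently_ex[OF frequently_eventually_frequently[OF cluster[OF V] this]]
  obtain t where t: "geo_exp (Complex t y) \<in> V" "start < t" "T - \<eta> < t" "t < T"
    by auto
  define z0 where "z0 = Complex t y"
  have z0: "z0 \<in> exp_dom" "geo_exp z0 \<in> U" "dist (f (geo_exp z0)) (f m) < \<rho> / 2"
    using below t by (auto simp: z0_def V_def dist_commute)
  \<comment> \<open>This constant makes the chart coordinate \<open>exp z + c\<close> fit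
    \<open>geo_exp\<close> at \<open>z0\<close>; \<open>K\<close> is the continuation through the
    chart.\<close>
  define c where "c = f (geo_exp z0) - exp z0"
  define K where "K = (\<lambda>z. inv_into U f (exp z + c))"
  have "\<forall>\<^sub>F z in nhds z0. z \<in> exp_dom \<and> geo_exp z = K z"
    using developsD(3)[OF develops_geo_exp z0(1) U(1) z0(2)] eventually_nhds_in_open[OF exp_dom_open z0(1)]
  proof eventually_elim
    case (elim z)
    then have "geo_exp z \<in> U" "exp z + c = f (geo_exp z)"
      by (simp_all add: c_def)
    then have "K z = geo_exp z"
      unfolding K_def using planar_chart_inj[OF chart[OF U(1)]] by (simp only: inv_into_f_f)
    then show ?case
      using elim(2) by simp
  qed
  then obtain d where d: "0 < d"
    "\<And>z. \<bar>Re z - t\<bar> < d \<Longrightarrow> \<bar>Im z - y\<bar> < d \<Longrightarrow> z \<in> exp_dom \<and> geo_exp z = K z"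
    unfolding z0_def by (rule eventually_nhds_box) blast
  have K_image: "exp z + c \<in> f ` U" if "\<bar>Re z - T\<bar> < \<eta>" "\<bar>Im z - y\<bar> < \<eta>" for z
  proof -
    have "dist (exp z0) (exp (Complex T y)) < \<rho> / 4" "dist (exp z) (exp (Complex T y)) < \<rho> / 4"
      using \<eta>(2)[of z0] \<eta>(2)[OF that] t \<eta>(1) by (simp_all add: z0_def)
    then have "dist (exp z) (exp z0) < \<rho> / 2"
      using dist_triangle2[of "exp z" "exp z0" "exp (Complex T y)"] by linarith
    moreover have "dist (exp z + c) (f (geo_exp z0)) = dist (exp z) (exp z0)"
      by (simp add: c_def dist_norm algebra_simps)
    ultimately have "dist (exp z + c) (f m) < \<rho>"
      using z0(3) dist_triangle[of "exp z + c" "f m" "f (geo_exp z0)"] by simp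
    then show ?thesis
      using \<rho>(2) by (auto simp: dist_commute)
  qed
  define e where "e = min d \<eta>"
  \<comment> \<open>Half-width of a box around \<open>t\<close> on which \<open>geo_exp\<close> and
    \<open>K\<close> coincide. The bounds keep it to the right of \<open>start\<close> and of
    \<open>T - \<eta>\<close>, where \<open>K_image\<close> applies.\<close>
  define \<delta> where "\<delta> = min d (min (t - start) (t - (T - \<eta>)))"
  have \<delta>: "0 < \<delta>" "\<delta> \<le> d" "\<delta> \<le> t - start" "\<delta> \<le> t - (T - \<eta>)" and e: "0 < e" "e \<le> d" "e \<le> \<eta>"
    using d(1) \<eta>(1) t by (auto simp: \<delta>_def e_def)
  \<comment> \<open>The strip is unbounded to the left, as a germ demands, and passes
    \<open>T\<close> on the right.\<close>
  define A where "A = {z. Re z < T + \<eta> \<and> \<bar>Im z - y\<bar> < e}"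
  define G where "G = (\<lambda>z. if Re z \<le> t then geo_exp z else K z)"
  have box: "z \<in> exp_dom" "geo_exp z = K z" if "\<bar>Re z - t\<bar> < \<delta>" "\<bar>Im z - y\<bar> < e" for z
    using d(2)[of z] that \<delta> e by auto
  have left_part: "z \<in> exp_dom" if "Re z < t + \<delta>" "\<bar>Im z - y\<bar> < e" for z
  proof (cases "Re z \<le> t")
    case True
    have "Complex t (Im z) \<in> exp_dom"
      by (rule box) (use that \<delta> in auto)
    moreover have "Complex t (Im z) - of_real (t - Re z) = z"
      by (simp add: complex_eq_iff)
    ultimately show ?thesis
      using exp_dom_left[of "Complex t (Im z)" "t - Re z"] True by simp
  next
    case False
    then show ?thesis using box(1)[of z] that by simp
  qed
  have "ext_germ A G"
    unfolding ext_germ_def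
  proof (intro conjI ballI allI impI)
    show "open A"
      unfolding A_def by (intro open_Collect_conj open_Collect_less continuous_intros)
    show "z - of_real s \<in> A" if "z \<in> A" "0 \<le> s" for z s
      using that by (auto simp: A_def)
    show "develops S exp A G"
    proof (rule develops_localI)
      fix a assume a: "a \<in> A"
      show "\<exists>N. open N \<and> a \<in> N \<and> develops S exp (A \<inter> N) G"
      \<comment> \<open>The half planes to the left of \<open>t + \<delta>\<close> and to the right
        of \<open>t - \<delta>\<close> overlap, and on the overlap within \<open>A\<close> both
        formulas for \<open>G\<close> agree.\<close>
      proof (cases "Re a < t + \<delta>")
        case True
        have "develops S exp (A \<inter> {z. Re z < t + \<delta>}) G"
        proof (rule develops_cong[where c = 0 and \<psi> = exp and H = geo_exp])
          show "develops S exp (A \<inter> {z. Re z < t + \<delta>}) geo_exp"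
            by (rule develops_subset[OF develops_geo_exp]) (use left_part in \<open>auto simp: A_def\<close>)
          show "G z = geo_exp z" if "z \<in> A \<inter> {z. Re z < t + \<delta>}" for z
            using box(2)[of z] that by (auto simp: G_def A_def)
        qed auto
        then show ?thesis
          using True by (intro exI[of _ "{z. Re z < t + \<delta>}"]) (auto simp: open_halfspace_Re_lt)
      next
        case False
        have "develops S exp (A \<inter> {z. Re z > t - \<delta>}) G"
        proof (rule develops_cong[where c = 0 and \<psi> = exp and H = K])
          show "develops S exp (A \<inter> {z. Re z > t - \<delta>}) K"
            unfolding K_def
          proof (rule develops_inv_chart[OF U(1)])
            show "exp z + c \<in> f ` U" if "z \<in> A \<inter> {z. Re z > t - \<delta>}" for z
              by (rule K_image) (use that \<delta> e in \<open>auto simp: A_def\<close>)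
          qed (intro continuous_intros)
          show "G z = K z" if "z \<in> A \<inter> {z. Re z > t - \<delta>}" for z
            using box(2)[of z] that by (auto simp: G_def A_def)
        qed auto
        then show ?thesis
          using False \<delta>(1) by (intro exI[of _ "{z. Re z > t - \<delta>}"]) (auto simp: open_halfspace_Re_gt)
      qed
    qed
    show "G z = cone_exp z" if "z \<in> A" "Re z < start" for z
      using that geo_exp_start[of z] left_part[of z] t \<delta> by (auto simp: G_def A_def)
  qed
  moreover have "Complex T y \<in> A"
    using \<eta>(1) e(1) by (simp add: A_def)
  ultimately show ?thesis
    unfolding exp_dom_def by blast
qed

text \<open>Let \<open>T\<close> be the abscissa at which the horizontal line through
  \<open>z\<close> first leaves \<open>exp_dom\<close>. By \<open>exp_dom_extend\<close> the ray has
  no regular cluster point there, so it ends at a singularity; reparametrised, it is a saddle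
  connection with vector \<open>exp (Complex T y)\<close>.\<close>

lemma exp_dom_or_saddle:
  assumes "z \<notin> exp_dom"
  obtains t where "0 \<le> t" "exp (z - of_real t) \<in> V_sc S"
proof -
  define y where "y = Im z"
  define P where "P = {t. Complex t y \<notin> exp_dom}"
  define T where "T = Inf P"
  have P_ge: "k * ln r \<le> t" if "t \<in> P" for t
    using exp_dom_halfplane[of "Complex t y"] that by (force simp: P_def)
  then have bdd: "bdd_below P"
    unfolding bdd_below_def by blast
  have zP: "Re z \<in> P"
    using assms by (simp add: P_def y_def)
  have T_le: "T \<le> Re z"
    unfolding T_def using zP bdd by (rule cInf_lower)
  have T_ge: "k * ln r \<le> T"
    unfolding T_def using zP P_ge by (intro cInf_greatest) auto
  have below: "Complex t y \<in> exp_dom" if "t < T" for t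
    using cInf_lower[OF _ bdd, of t] that unfolding T_def[symmetric] by (force simp: P_def)
  \<comment> \<open>As \<open>exp_dom\<close> is open, the infimum \<open>T\<close> is attained in
    \<open>P\<close>.\<close>
  have T_notin: "Complex T y \<notin> exp_dom"
  proof
    assume "Complex T y \<in> exp_dom"
    then have "\<forall>\<^sub>F z in nhds (Complex T y). z \<in> exp_dom"
      by (rule eventually_nhds_in_open[OF exp_dom_open])
    then obtain d where d: "0 < d" "\<And>z. \<bar>Re z - T\<bar> < d \<Longrightarrow> \<bar>Im z - y\<bar> < d \<Longrightarrow> z \<in> exp_dom"
      by (rule eventually_nhds_box) blast
    have "T + d \<le> t" if "t \<in> P" for t
    proof (rule ccontr)
      assume "\<not> T + d \<le> t"
      moreover have "T \<le> t"
        unfolding T_def using that bdd by (rule cInf_lower)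
      ultimately have "Complex t y \<in> exp_dom"
        using d by simp
      with that show False
        by (simp add: P_def)
    qed
    then have "T + d \<le> T"
      unfolding T_def using zP by (intro cInf_greatest) auto
    with d(1) show False by simp
  qed
  define g where "g = (\<lambda>t. geo_exp (Complex t y))"
  have cont: "continuous_on {..<T} (\<lambda>t. Complex t y)" "continuous_on {..<T} (\<lambda>t. exp (Complex t y))"
    unfolding Complex_eq by (intro continuous_intros)+
  have dev: "develops S (\<lambda>t. exp (Complex t y)) {..<T} g"
    unfolding g_def by (rule develops_compose[OF develops_geo_exp cont(1)]) (use below in auto)
  obtain s where s: "s \<in> sing S" "limitin X g s (at_left T)"
  proof (rule develops_limit_singular[OF dev cont(2)])
    fix m assume m: "m \<in> topspace X" "m \<notin> sing S"
    show "\<exists>V. openin X V \<and> m \<in> V \<and> (\<forall>\<^sub>F t in at_left T. g t \<notin> V)"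
    proof (rule ccontr)
      assume no: "\<not> ?thesis"
      have "\<exists>\<^sub>F t in at_left T. geo_exp (Complex t y) \<in> V" if "openin X V" "m \<in> V" for V
        using no that unfolding frequently_def g_def by blast
      with exp_dom_extend[OF T_ge below m] T_notin show False by blast
    qed
  qed
  define v where "v = exp (Complex T y)"
  \<comment> \<open>The substitution \<open>\<tau> = exp (t - T)\<close> turns the logarithmic
    parameter into constant velocity on the unit interval, since
    \<open>exp (Complex (ln \<tau> + T) y) = \<tau> * v\<close>. The end points \<open>p\<close> and
    \<open>s\<close> are added separately.\<close>
  define \<sigma> where "\<sigma> = (\<lambda>\<tau>::real. if \<tau> \<le> 0 then p else if 1 \<le> \<tau> then s else g (ln \<tau> + T))"
  have \<sigma>_eq: "\<sigma> \<tau> = g (ln \<tau> + T)" if "0 < \<tau>" "\<tau> < 1" for \<tau>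
    using that by (simp add: \<sigma>_def)
  have exp_ln: "exp (Complex (ln \<tau> + T) y) = of_real \<tau> * v" if "0 < \<tau>" for \<tau>
  proof -
    have "Complex (ln \<tau> + T) y = of_real (ln \<tau>) + Complex T y"
      by (simp add: complex_eq_iff)
    then show ?thesis
      using that by (simp add: exp_add v_def exp_of_real)
  qed
  have dev\<sigma>: "develops S (\<lambda>\<tau>. of_real \<tau> * v) {0<..<1} \<sigma>"
  proof (rule develops_cong[where c = 0])
    show "develops S (\<lambda>\<tau>. exp (Complex (ln \<tau> + T) y)) {0<..<1} (\<lambda>\<tau>. g (ln \<tau> + T))"
      by (rule develops_compose[OF dev]) (auto intro!: continuous_intros)
  qed (use \<sigma>_eq exp_ln in auto)
  have cont\<sigma>: "continuous_on {0<..<1} (\<lambda>\<tau>::real. of_real \<tau> * v)"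
    by (intro continuous_intros)
  have "pathin X \<sigma>"
  proof (rule pathinI)
    fix x :: real and V assume x: "x \<in> {0..1}" and V: "openin X V" "\<sigma> x \<in> V"
    have "\<exists>N. open N \<and> x \<in> N \<and> (\<forall>t\<in>N. t \<in> {0..1} \<longrightarrow> \<sigma> t \<in> V)"
    proof -
      consider "x = 0" | "x = 1" | "x \<in> {0<..<1}"
        using x by force
      then show ?thesis
      proof cases
        case 1
        then have "p \<in> V" using V(2) by (simp add: \<sigma>_def)
        then obtain T' where T': "\<And>z. Re z < T' \<Longrightarrow> cone_exp z \<in> V"
          using cone_exp_limit V(1) by blast
        \<comment> \<open>For positive \<open>\<tau>\<close> in \<open>N\<close>,
          \<open>ln \<tau> + T\<close> lies to the left of \<open>T'\<close> and of
          \<open>start\<close>, where \<open>geo_exp\<close> equals \<open>cone_exp\<close> and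
          takes values in \<open>V\<close>; the bound 1 excludes the other end.\<close>
        define N where "N = {..<min 1 (exp (min T' start - T))}"
        have "\<sigma> t \<in> V" if t: "t \<in> N" "t \<in> {0..1}" for t
        proof (cases "t = 0")
          case True
          then show ?thesis using \<open>p \<in> V\<close> by (simp add: \<sigma>_def)
        next
          case False
          then have t': "0 < t" "t < 1" "t < exp (min T' start - T)"
            using t by (auto simp: N_def)
          then have "ln t < min T' start - T"
            by (metis exp_less_cancel_iff exp_ln_iff)
          then have *: "ln t + T < T'" "ln t + T < start" by auto
          have "\<sigma> t = cone_exp (Complex (ln t + T) y)"
            unfolding \<sigma>_eq[OF t'(1,2)] g_def
            by (rule geo_exp_start) (use * T_ge in \<open>auto intro!: below simp: start_def\<close>)
          then show ?thesis
            using T' * by simp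
        qed
        then show ?thesis
          using 1 by (intro exI[of _ N]) (auto simp: N_def)
      next
        case 2
        then have "s \<in> V" using V(2) by (simp add: \<sigma>_def)
        then obtain c where c: "c < T" "\<And>t. c < t \<Longrightarrow> t < T \<Longrightarrow> g t \<in> V"
          using limitin_at_leftD[OF s(2) V(1)] by blast
        \<comment> \<open>In the parameter of \<open>g\<close> the lower bound on \<open>t\<close>
          reads \<open>c < ln t + T\<close>.\<close>
        have "\<sigma> t \<in> V" if t: "exp (c - T) < t" "t \<in> {0..1}" for t
        proof (cases "t = 1")
          case True
          then show ?thesis using \<open>s \<in> V\<close> by (simp add: \<sigma>_def)
        next
          case False
          have "0 < t"
            using t(1) exp_gt_zero[of "c - T"] by linarith
          then have t': "0 < t" "t < 1"
            using t False by auto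
          then have "c - T < ln t" "ln t < 0"
            using t(1) by (metis exp_less_cancel_iff exp_ln_iff, simp)
          then show ?thesis
            unfolding \<sigma>_eq[OF t'] by (intro c(2)) auto
        qed
        moreover have "exp (c - T) < 1" using c(1) by simp
        ultimately show ?thesis
          using 2 by (intro exI[of _ "{exp (c - T)<..}"]) auto
      next
        case 3
        have "\<forall>\<^sub>F t in nhds x. t \<in> {0<..<1} \<longrightarrow> \<sigma> t \<in> V"
          by (rule develops_eventually[OF dev\<sigma> cont\<sigma> 3 V])
        then obtain N where "open N" "x \<in> N" "\<forall>t\<in>N. t \<in> {0<..<1} \<longrightarrow> \<sigma> t \<in> V"
          unfolding eventually_nhds by blast
        then show ?thesis
          using 3 by (intro exI[of _ "N \<inter> {0<..<1}"]) auto
      qed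
    qed
    then show "\<forall>\<^sub>F t in nhds x. t \<in> {0..1} \<longrightarrow> \<sigma> t \<in> V"
      unfolding eventually_nhds .
  next
    fix x :: real assume "x \<in> {0..1}"
    then show "\<sigma> x \<in> topspace X"
      using developsD(1)[OF dev\<sigma>, of x] p_sing s(1) sing_subset
      by (cases "x \<in> {0<..<1}") (auto simp: \<sigma>_def)
  qed
  moreover have "\<forall>\<^sub>F t' in nhds t. f (\<sigma> t') = f (\<sigma> t) + (t' - t) *\<^sub>R v"
    if "(U, f) \<in> atlas S" "t \<in> {0<..<1}" "\<sigma> t \<in> U" for U f t
    using developsD(3)[OF dev\<sigma> that(2,1,3)] eventually_nhds_in_open[OF open_greaterThanLessThan that(2)]
    by eventually_elim (auto simp: scaleR_conv_of_real algebra_simps)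
  moreover have ends: "v \<noteq> 0" "\<sigma> 0 \<in> sing S" "\<sigma> 1 \<in> sing S"
    using p_sing s(1) by (auto simp: \<sigma>_def v_def)
  ultimately have "saddle_connection S \<sigma> v"
    unfolding saddle_connection_def
    using developsD(2)[OF dev\<sigma>] ends by blast
  then have "v \<in> V_sc S"
    unfolding V_sc_def by blast
  moreover have "z - of_real (Re z - T) = Complex T y"
    by (simp add: complex_eq_iff y_def)
  ultimately show ?thesis
    using that[of "Re z - T"] T_le by (simp add: v_def)
qed

section \<open>Convex sets without saddle connection vectors\<close>

text \<open>The vectors \<open>exp (z - t)\<close> with \<open>t \<ge> 0\<close> lie on the segment
  from 0 to \<open>exp z\<close>, hence in \<open>C\<close>, so none of them is a saddle connection
  vector.\<close>

lemma exp_dom_convex: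
  assumes "convex C" "0 \<in> C" "C \<inter> V_sc S = {}" "exp z \<in> C"
  shows "z \<in> exp_dom"
proof (rule ccontr)
  assume "z \<notin> exp_dom"
  then obtain t where t: "0 \<le> t" "exp (z - of_real t) \<in> V_sc S"
    by (rule exp_dom_or_saddle)
  have "exp (z - of_real t) = (1 - exp (- t)) *\<^sub>R 0 + exp (- t) *\<^sub>R exp z"
    by (simp add: exp_diff exp_minus scaleR_conv_of_real exp_of_real field_simps)
  also have "\<dots> \<in> C"
    using assms t(1) by (intro convexD) auto
  finally show False
    using t(2) assms(3) by blast
qed

text \<open>Two geodesics with velocity \<open>- exp z\<close> start at the common point: the ray of
  \<open>z\<close> run backwards, which falls into \<open>p\<close> at time 1, and the image of
  \<open>w\<close>, which is regular up to and including time 1. They agree before time 1, so their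
  limits at time 1 contradict the Hausdorff property.\<close>

lemma geo_exp_no_meeting:
  assumes w: "continuous_on {0..1} w" "w ` {0..1} \<subseteq> exp_dom"
    and exp_w: "\<And>s. s \<in> {0..1} \<Longrightarrow> exp (w s) = exp (w 0) - of_real s * exp z"
    and z: "z \<in> exp_dom" and meet: "geo_exp (w 0) = geo_exp z"
  shows False
proof -
  \<comment> \<open>The ray of \<open>z\<close> traversed towards \<open>p\<close>:
    \<open>exp (u s) = (1 - s) * exp z\<close> for \<open>s < 1\<close>.\<close>
  define u where "u = (\<lambda>s::real. z + of_real (ln (1 - s)))"
  have u_dom: "u s \<in> exp_dom" if "s \<in> {0..<1}" for s
    using exp_dom_left[OF z, of "- ln (1 - s)"] that by (simp add: u_def)
  have cw: "continuous_on {0..1} (\<lambda>s. exp (w s))"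
    by (intro continuous_intros w)
  have cu: "continuous_on {0..<1} u" "continuous_on {0..<1} (\<lambda>s. exp (u s))"
    unfolding u_def by (auto intro!: continuous_intros)
  have dev_w: "develops S (\<lambda>s. exp (w s)) {0..1} (\<lambda>s. geo_exp (w s))"
    by (rule develops_compose[OF develops_geo_exp w])
  have dev_u: "develops S (\<lambda>s. exp (u s)) {0..<1} (\<lambda>s. geo_exp (u s))"
    by (rule develops_compose[OF develops_geo_exp cu(1)]) (use u_dom in auto)
  have exp_u: "exp (u s) = (1 - of_real s) * exp z" if "s \<in> {0..<1}" for s
  proof -
    have "exp (of_real (ln (1 - s))) = complex_of_real (1 - s)"
      using that by (simp add: exp_of_real)
    then show ?thesis
      by (simp add: u_def exp_add)
  qed
  have eq: "geo_exp (w s) = geo_exp (u s)" if s: "s \<in> {0..<1}" for s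
  proof (rule develops_unique[OF _ _ dev_u _ cu(2)])
    show "develops S (\<lambda>s. exp (w s)) {0..<1} (\<lambda>s. geo_exp (w s))"
      by (rule develops_subset[OF dev_w]) auto
    show "continuous_on {0..<1} (\<lambda>s. exp (w s))"
      by (rule continuous_on_subset[OF cw]) auto
    show "exp (w t) = exp (u t) + (exp (w 0) - exp z)" if "t \<in> {0..<1}" for t
      using exp_w[of t] that unfolding exp_u[OF that] by (simp add: algebra_simps)
    show "geo_exp (w 0) = geo_exp (u 0)"
      using meet by (simp add: u_def)
  qed (use s in auto)
  have "geo_exp (w 1) \<in> topspace X" "geo_exp (w 1) \<noteq> p" "p \<in> topspace X"
    using developsD(1,2)[OF dev_w, of 1] p_sing sing_subset by auto
  then obtain V W where VW: "openin X V" "openin X W" "geo_exp (w 1) \<in> V" "p \<in> W" "disjnt V W"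
    using Hausdorff unfolding Hausdorff_space_def by metis
  obtain T where T: "\<And>z. Re z < T \<Longrightarrow> cone_exp z \<in> W"
    by (rule cone_exp_limit[OF VW(2,4)]) (rule that)
  have "\<forall>\<^sub>F s in nhds 1. s \<in> {0..1} \<longrightarrow> geo_exp (w s) \<in> V"
    by (rule develops_eventually[OF dev_w cw _ VW(1,3)]) simp
  then obtain d where d: "0 < d" "\<And>s. dist s 1 < d \<Longrightarrow> s \<in> {0..1} \<Longrightarrow> geo_exp (w s) \<in> V"
    unfolding eventually_nhds_metric by auto
  \<comment> \<open>At time \<open>1 - e\<close> the common point is in \<open>V\<close> because the
    time is close to 1, and in \<open>W\<close> because \<open>ln e\<close> moves \<open>u\<close>
    to the left of \<open>T\<close> and \<open>start\<close>. The bound \<open>1 / 2\<close> keeps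
    the time inside the unit interval.\<close>
  define e where "e = min (1 / 2) (min (d / 2) (exp (min T start - Re z - 1)))"
  have e: "0 < e" "e < 1" "e < d" "e \<le> exp (min T start - Re z - 1)"
    using d(1) by (auto simp: e_def)
  have "ln e \<le> min T start - Re z - 1"
    using e(1,4) by (metis exp_le_cancel_iff exp_ln_iff)
  then have "Re (u (1 - e)) < T" "Re (u (1 - e)) < start"
    by (auto simp: u_def)
  then have "geo_exp (u (1 - e)) \<in> W"
    using T geo_exp_start[OF u_dom[of "1 - e"]] e by simp
  moreover have "geo_exp (u (1 - e)) \<in> V"
    using d(2)[of "1 - e"] eq[of "1 - e"] e by (simp add: dist_norm)
  ultimately show False
    using VW(5) by (auto simp: disjnt_iff)
qed

text \<open>The segment from \<open>exp z2\<close> to \<open>exp z2 - exp z1\<close> lies in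
  \<open>C\<close>, since its end points are midpoints of points of \<open>C\<close>. The condition
  \<open>ratio\<close> says that it misses 0, so it lifts to a path \<open>w\<close> of logarithms
  to which \<open>geo_exp_no_meeting\<close> applies.\<close>

lemma geo_exp_neq:
  assumes C: "convex C" "\<And>v. v \<in> C \<Longrightarrow> - v \<in> C" "C \<inter> V_sc S = {}"
    and z: "2 * exp z1 \<in> C" "2 * exp z2 \<in> C"
    and ratio: "\<not> (\<exists>l\<ge>1. exp z1 = of_real l * exp z2)"
  shows "geo_exp z2 \<noteq> geo_exp z1"
proof
  assume meet: "geo_exp z2 = geo_exp z1"
  define q where "q = exp z1 / exp z2"
  have mid: "(1 / 2) *\<^sub>R (u + v) \<in> C" if "u \<in> C" "v \<in> C" for u v
    using convexD[OF C(1) that, of "1 / 2" "1 / 2"] by (simp add: scaleR_add_right)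
  have C0: "0 \<in> C"
    using mid[OF z(1) C(2)[OF z(1)]] by simp
  have y: "exp z2 \<in> C" and x: "exp z1 \<in> C" and yx: "exp z2 - exp z1 \<in> C"
    using mid[OF z(2) C0] mid[OF z(1) C0] mid[OF z(2) C(2)[OF z(1)]]
    by (simp_all add: scaleR_conv_of_real algebra_simps)
  \<comment> \<open>The branch cut of \<open>Ln\<close> is avoided: on it \<open>s * q\<close> would
    be real and at least 1, hence so would \<open>q\<close>, contrary to
    \<open>ratio\<close>.\<close>
  have q: "1 - of_real s * q \<notin> \<real>\<^sub>\<le>\<^sub>0" if s: "s \<in> {0..1}" for s
  proof
    assume "1 - of_real s * q \<in> \<real>\<^sub>\<le>\<^sub>0"
    then obtain c where c: "c \<le> 0" "1 - of_real s * q = of_real c"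
      by (auto elim: nonpos_Reals_cases)
    then have sq: "of_real s * q = of_real (1 - c)"
      by (simp add: algebra_simps)
    then have "s \<noteq> 0"
      using c(1) by auto
    then have "q = of_real ((1 - c) / s)"
      using sq by (simp add: field_simps)
    moreover have "(1 - c) / s \<ge> 1"
      using s c(1) \<open>s \<noteq> 0\<close> by (simp add: field_simps)
    ultimately have "\<exists>l\<ge>1. exp z1 = of_real l * exp z2"
      by (intro exI[of _ "(1 - c) / s"]) (auto simp: q_def field_simps)
    with ratio show False by blast
  qed
  \<comment> \<open>As \<open>Ln 1 = 0\<close>, the lift starts at \<open>z2\<close> itself and so
    on the sheet of \<open>z2\<close>, which the vector \<open>exp z2\<close> alone does not
    determine.\<close>
  define w where "w = (\<lambda>s::real. z2 + Ln (1 - of_real s * q))"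
  have exp_w: "exp (w s) = exp z2 - of_real s * exp z1" if "s \<in> {0..1}" for s
  proof -
    have "1 - of_real s * q \<noteq> 0"
      using q[OF that] by auto
    then show ?thesis
      by (simp add: w_def exp_add q_def field_simps)
  qed
  show False
  proof (rule geo_exp_no_meeting)
    show "continuous_on {0..1} w"
      unfolding w_def using q by (intro continuous_intros) auto
    show "w ` {0..1} \<subseteq> exp_dom"
    proof safe
      fix s :: real assume s: "s \<in> {0..1}"
      have "exp (w s) = (1 - s) *\<^sub>R exp z2 + s *\<^sub>R (exp z2 - exp z1)"
        using exp_w[OF s] by (simp add: scaleR_conv_of_real algebra_simps)
      also have "\<dots> \<in> C"
        using s by (intro convexD[OF C(1) y yx]) auto
      finally show "w s \<in> exp_dom"
        by (rule exp_dom_convex[OF C(1) C0 C(3)])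
    qed
    show "z1 \<in> exp_dom"
      by (rule exp_dom_convex[OF C(1) C0 C(3) x])
    show "exp (w s) = exp (w 0) - of_real s * exp z1" if "s \<in> {0..1}" for s
      using exp_w[OF that] exp_w[of 0] by simp
    show "geo_exp (w 0) = geo_exp z1"
      using meet by (simp add: w_def)
  qed
qed

text \<open>Removing the nonpositive reals makes \<open>Ln\<close> continuous and selects one sheet
  of angle \<open>2 * pi\<close> at the cone point. For two vectors with the same image,
  \<open>geo_exp_neq\<close> in both orders shows that each is a multiple of the other by a real
  factor at least 1, so they are equal.\<close>

lemma embedded_half:
  assumes C: "convex C" "\<And>v. v \<in> C \<Longrightarrow> - v \<in> C" "C \<inter> V_sc S = {}"
  defines "D' \<equiv> {v. 2 * v \<in> C} - \<real>\<^sub>\<le>\<^sub>0"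
  shows "develops S (\<lambda>v. v) D' (\<lambda>v. geo_exp (Ln v))" "inj_on (\<lambda>v. geo_exp (Ln v)) D'"
proof -
  have D: "2 * v \<in> C" "v \<noteq> 0" "v \<notin> \<real>\<^sub>\<le>\<^sub>0" if "v \<in> D'" for v
    using that by (auto simp: D'_def)
  have "Ln v \<in> exp_dom" if v: "v \<in> D'" for v
  proof -
    have mid: "(1 / 2) *\<^sub>R (u + w) \<in> C" if "u \<in> C" "w \<in> C" for u w
      using convexD[OF C(1) that, of "1 / 2" "1 / 2"] by (simp add: scaleR_add_right)
    have 0: "0 \<in> C"
      using mid[OF D(1)[OF v] C(2)[OF D(1)[OF v]]] by simp
    have "v \<in> C"
      using mid[OF D(1)[OF v] 0] by (simp add: scaleR_conv_of_real)
    then show ?thesis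
      using D(2)[OF v] by (intro exp_dom_convex[OF C(1) 0 C(3)]) simp
  qed
  then have "develops S (\<lambda>v. exp (Ln v)) D' (\<lambda>v. geo_exp (Ln v))"
    using D(3) by (intro develops_compose[OF develops_geo_exp] continuous_intros) auto
  then show "develops S (\<lambda>v. v) D' (\<lambda>v. geo_exp (Ln v))"
    by (rule develops_cong[where c = 0]) (use D(2) in auto)
  show "inj_on (\<lambda>v. geo_exp (Ln v)) D'"
  proof (rule inj_onI)
    fix x y assume xy: "x \<in> D'" "y \<in> D'" "geo_exp (Ln x) = geo_exp (Ln y)"
    have "\<exists>l\<ge>1. x = of_real l * y"
      using geo_exp_neq[OF C, of "Ln x" "Ln y"] xy D by auto
    moreover have "\<exists>l\<ge>1. y = of_real l * x"
      using geo_exp_neq[OF C, of "Ln y" "Ln x"] xy D by auto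
    ultimately obtain l l' where l: "l \<ge> 1" "l' \<ge> 1" "x = of_real l * y" "y = of_real l' * x"
      by blast
    then have "norm x = l * norm y" "norm y = l' * norm x"
      by (metis abs_of_nonneg norm_mult norm_of_real order_trans zero_le_one)+
    moreover have "1 * norm y \<le> l * norm y" "1 * norm x \<le> l' * norm x"
      by (rule mult_right_mono; use l(1,2) in simp)+
    ultimately have "(l - 1) * norm y = 0"
      unfolding left_diff_distrib mult_1 by linarith
    then have "l = 1"
      using D(2)[OF xy(2)] by simp
    then show "x = y" using l(3) by simp
  qed
qed

end

subsection \<open>Area\<close>

text \<open>The Borel sigma-algebra of \<open>X\<close>, shared by all chart measures.\<close>

abbreviation open_sigma :: "'a topology \<Rightarrow> 'a measure" where
  "open_sigma X \<equiv> sigma (topspace X) {W. openin X W}"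

lemma open_sigma_Pow: "{W. openin X W} \<subseteq> Pow (topspace X)"
  using openin_subset by auto

lemma sets_open_sigmaI: "openin X W \<Longrightarrow> W \<in> sets (open_sigma X)"
  using open_sigma_Pow[of X] by (auto simp: sets_measure_of intro: sigma_sets.Basic)

lemma planar_chart_vimage_sets:
  assumes "planar_chart X U f" "B \<in> sets borel"
  shows "{q \<in> U. f q \<in> B} \<in> sets (open_sigma X)"
proof -
  have U: "U \<in> sets (open_sigma X)" "U \<subseteq> topspace X"
    using planar_chart_openin[OF assms(1)] openin_subset by (auto intro!: sets_open_sigmaI)
  then have space: "space (restrict_space (open_sigma X) U) = U"
    using open_sigma_Pow[of X] by (auto simp: space_restrict_space space_measure_of)
  have sets: "A \<in> sets (restrict_space (open_sigma X) U) \<longleftrightarrow> A \<subseteq> U \<and> A \<in> sets (open_sigma X)" for A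
    using U by (intro sets_restrict_space_iff) (simp add: sets.Int_space_eq1 Int_commute)
  have "f \<in> borel_measurable (restrict_space (open_sigma X) U)"
  proof (rule borel_measurableI)
    fix W :: "complex set" assume "open W"
    then have "{q \<in> U. f q \<in> W} \<in> sets (open_sigma X)"
      by (intro sets_open_sigmaI planar_chart_openin_vimage[OF assms(1)])
    moreover have "f -` W \<inter> U = {q \<in> U. f q \<in> W}"
      by auto
    ultimately show "f -` W \<inter> space (restrict_space (open_sigma X) U) \<in> sets (restrict_space (open_sigma X) U)"
      unfolding sets space by auto
  qed
  from measurable_sets[OF this assms(2)] have "f -` B \<inter> U \<in> sets (open_sigma X)"
    unfolding sets space by auto
  moreover have "f -` B \<inter> U = {q \<in> U. f q \<in> B}"
    by auto
  ultimately show ?thesis by simp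
qed

lemma sets_chart_measure: "sets (chart_measure X U f) = sets (open_sigma X)"
  by (simp add: chart_measure_def)

text \<open>The measure is pushed forward by the inverse chart, and the preimage of the given set
  under the inverse chart is \<open>B\<close> again.\<close>

lemma emeasure_chart_measure:
  assumes "planar_chart X U f" "B \<in> sets borel" "B \<subseteq> f ` U"
  shows "emeasure (chart_measure X U f) {q \<in> U. f q \<in> B} = emeasure lborel B"
proof -
  have o: "open (f ` U)" and inj: "inj_on f U"
    using assms(1) planar_chart_inj by (auto simp: planar_chart_def)
  let ?R = "restrict_space lborel (f ` U) :: complex measure"
  have space: "space ?R = f ` U"
    by (simp add: space_restrict_space)
  have meas: "inv_into U f \<in> measurable ?R (open_sigma X)"
  proof (rule measurable_measure_of[OF open_sigma_Pow])
    show "inv_into U f \<in> space ?R \<rightarrow> topspace X"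
      unfolding space using openin_subset[OF planar_chart_openin[OF assms(1)]]
      by (auto simp: inv_into_f_f[OF inj])
    fix W assume "W \<in> {W. openin X W}"
    then have "open (f ` (U \<inter> W))"
      using planar_chart_open_image[OF assms(1)] by simp
    moreover have "inv_into U f -` W \<inter> f ` U = f ` (U \<inter> W)"
      using inv_into_f_f[OF inj] by auto
    ultimately show "inv_into U f -` W \<inter> space ?R \<in> sets ?R"
      unfolding space using o by (subst sets_restrict_space_iff) auto
  qed
  have "emeasure (chart_measure X U f) {q \<in> U. f q \<in> B} =
      emeasure ?R (inv_into U f -` {q \<in> U. f q \<in> B} \<inter> f ` U)"
    unfolding chart_measure_def
    by (subst emeasure_distr[OF meas planar_chart_vimage_sets[OF assms(1,2)]]) (simp add: space)
  also have "inv_into U f -` {q \<in> U. f q \<in> B} \<inter> f ` U = B"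
    using inv_into_f_f[OF inj] assms(3) by (auto simp: f_inv_into_f inv_into_into)
  also have "emeasure ?R B = emeasure lborel B"
    using o assms(3) by (intro emeasure_restrict_space) auto
  finally show ?thesis .
qed

lemma emeasure_lborel_diff_vimage:
  fixes c :: "'a::euclidean_space"
  assumes "B \<in> sets borel"
  shows "emeasure lborel {w. w - c \<in> B} = emeasure lborel B" "{w. w - c \<in> B} \<in> sets borel"
proof -
  have eq: "(+) (- c) -` B = {w. w - c \<in> B}"
    by auto
  have m: "(+) (- c) \<in> borel_measurable borel"
    by simp
  show "{w. w - c \<in> B} \<in> sets borel"
    using measurable_sets[OF m assms] by (simp add: eq)
  have "emeasure lborel B = emeasure (distr lborel borel ((+) (- c))) B"
    by (simp add: lborel_distr_plus)
  also have "\<dots> = emeasure lborel {w. w - c \<in> B}"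
    using assms by (subst emeasure_distr) (simp_all add: eq)
  finally show "emeasure lborel {w. w - c \<in> B} = emeasure lborel B" ..
qed

section \<open>Area of embedded planar sets\<close>

context translation_surface
begin

text \<open>The case of no charts is excluded because the least upper bound of no measures is the
  bottom measure, whose space is empty.\<close>

lemma sets_area_measure:
  assumes "atlas S \<noteq> {}"
  shows "sets (area_measure S) = sets (open_sigma X)"
  unfolding area_measure_def by (rule sets_SUP) (use assms in \<open>auto simp: sets_chart_measure\<close>)

text \<open>The order on measures compares values set by set once the sigma-algebras agree. This is
  how area on the surface is bounded from below.\<close>

lemma chart_measure_le_area:
  assumes "(U, f) \<in> atlas S"
  shows "emeasure (chart_measure X U f) A \<le> emeasure (area_measure S) A"
proof (rule le_measureD3)
  show "chart_measure X U f \<le> area_measure S"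
    unfolding area_measure_def using assms by (intro SUP_upper2[of "(U, f)"]) auto
  show "sets (chart_measure X U f) = sets (area_measure S)"
    using assms sets_area_measure by (auto simp: sets_chart_measure)
qed

text \<open>In charts \<open>F\<close> is locally a translation and so preserves area. Countably
  many patches cover \<open>D\<close>; they are cut into disjoint Borel pieces, whose images are
  disjoint by injectivity, and the areas are summed.\<close>

lemma vol_ge_embedded:
  assumes dev: "develops S (\<lambda>v. v) D F" and D: "open D" and inj: "inj_on F D"
  shows "emeasure lborel D \<le> vol S"
proof (cases "D = {}")
  case False
  \<comment> \<open>Patches that \<open>F\<close> maps into one chart, where it is the translation
    by \<open>c\<close>.\<close>
  define good where "good = (\<lambda>N (U, f, c). open N \<and> N \<subseteq> D \<and> (U, f) \<in> atlas S \<and>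
    (\<forall>v\<in>N. F v \<in> U \<and> f (F v) = v + c))"
  define \<G> where "\<G> = {N. \<exists>a. good N a}"
  have \<G>: "open N" "N \<subseteq> D" if "N \<in> \<G>" for N
    using that by (auto simp: \<G>_def good_def)
  have "\<exists>N\<in>\<G>. v \<in> N" if v: "v \<in> D" for v
  proof -
    obtain U f where U: "(U, f) \<in> atlas S" "F v \<in> U"
      by (rule chart_exists[of "F v"]) (use developsD(1,2)[OF dev v] in auto)
    have "\<forall>\<^sub>F b in nhds v. b \<in> D \<and> F b \<in> U \<and> f (F b) = b + (f (F v) - v)"
      using developsD(3)[OF dev v U] eventually_nhds_in_open[OF D v]
      by eventually_elim auto
    then obtain N where N: "open N" "v \<in> N" "\<forall>b\<in>N. b \<in> D \<and> F b \<in> U \<and> f (F b) = b + (f (F v) - v)"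
      unfolding eventually_nhds by blast
    then have "good N (U, f, f (F v) - v)"
      unfolding good_def prod.case using U(1) by blast
    with N(2) show ?thesis
      unfolding \<G>_def by blast
  qed
  then have cover: "D = \<Union>\<G>"
    using \<G>(2) by blast
  obtain \<N> where \<N>: "\<N> \<subseteq> \<G>" "countable \<N>" "\<Union>\<N> = \<Union>\<G>"
    using Lindelof[of \<G>] \<G>(1) by blast
  \<comment> \<open>The enumeration may repeat patches; \<open>disjointed\<close> turns repetitions
    into empty pieces.\<close>
  define N where "N = from_nat_into \<N>"
  have "\<N> \<noteq> {}"
    using \<N>(3) cover False by auto
  then have N: "range N = \<N>"
    using \<N>(2) by (simp add: N_def)
  then have "\<exists>a. good (N i) a" for i
    using \<N>(1) unfolding \<G>_def by blast
  then obtain a where a: "\<And>i. good (N i) (a i)"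
    by metis
  define U where "U = (\<lambda>i. fst (a i))"
  define f where "f = (\<lambda>i. fst (snd (a i)))"
  define c where "c = (\<lambda>i. snd (snd (a i)))"
  have ch: "open (N i)" "N i \<subseteq> D" "(U i, f i) \<in> atlas S"
    and F: "\<And>v. v \<in> N i \<Longrightarrow> F v \<in> U i" "\<And>v. v \<in> N i \<Longrightarrow> f i (F v) = v + c i" for i
    using a[of i] by (simp_all add: good_def U_def f_def c_def case_prod_beta)
  have DN: "D = (\<Union>i. N i)"
    using cover \<N>(3) N(1) by auto
  define B where "B = disjointed N"
  have BN: "B i \<subseteq> N i" and B_borel: "B i \<in> sets borel" for i
    using sets.range_disjointed_sets[of N borel] ch(1) disjointed_subset[of N i]
    by (auto simp: B_def image_subset_iff)
  have B_disj: "disjoint_family B" and B_un: "(\<Union>i. B i) = D"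
    by (simp_all add: B_def disjoint_family_disjointed UN_disjointed_eq DN)
  \<comment> \<open>The image of a piece is the preimage under a chart of a translated Borel set,
    which makes it measurable and gives its area in that chart.\<close>
  have FB: "F ` B i = {q \<in> U i. f i q \<in> {w. w - c i \<in> B i}}" for i
  proof safe
    fix v assume v: "v \<in> B i"
    with BN have "v \<in> N i" by blast
    then show "F v \<in> U i" "f i (F v) - c i \<in> B i"
      using F v by auto
  next
    fix q assume q: "q \<in> U i" "f i q - c i \<in> B i"
    then have "f i q - c i \<in> N i"
      using BN by blast
    then have "F (f i q - c i) \<in> U i" "f i (F (f i q - c i)) = f i q"
      using F[of "f i q - c i" i] by auto
    then have "F (f i q - c i) = q"
      using planar_chart_inj[OF chart[OF ch(3)[of i]]] q(1) by (auto simp: inj_on_def)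
    then show "q \<in> F ` B i"
      using q(2) by (metis imageI)
  qed
  have sub: "{w. w - c i \<in> B i} \<subseteq> f i ` U i" for i
  proof safe
    fix w assume "w - c i \<in> B i"
    then have "w - c i \<in> N i"
      using BN by blast
    then show "w \<in> f i ` U i"
      using F[of "w - c i" i] by (metis add.commute diff_add_cancel imageI)
  qed
  have sets_eq: "sets (area_measure S) = sets (open_sigma X)"
    using ch(3) by (intro sets_area_measure) auto
  have FB_sets: "F ` B i \<in> sets (area_measure S)" for i
    unfolding FB sets_eq
    by (rule planar_chart_vimage_sets[OF chart[OF ch(3)] emeasure_lborel_diff_vimage(2)[OF B_borel]])
  have le: "emeasure lborel (B i) \<le> emeasure (area_measure S) (F ` B i)" for i
  proof -
    have "emeasure lborel (B i) = emeasure lborel {w. w - c i \<in> B i}"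
      by (simp add: emeasure_lborel_diff_vimage(1)[OF B_borel])
    also have "\<dots> = emeasure (chart_measure X (U i) (f i)) (F ` B i)"
      unfolding FB
      by (rule emeasure_chart_measure[OF chart[OF ch(3)] emeasure_lborel_diff_vimage(2)[OF B_borel] sub, symmetric])
    also have "\<dots> \<le> emeasure (area_measure S) (F ` B i)"
      by (rule chart_measure_le_area[OF ch(3)])
    finally show ?thesis .
  qed
  have BD: "B i \<subseteq> D" for i
    using BN ch(2) by blast
  have disj: "disjoint_family (\<lambda>i. F ` B i)"
    unfolding disjoint_family_on_def
  proof (intro ballI impI)
    fix i j :: nat assume "i \<noteq> j"
    then have "B i \<inter> B j = {}"
      using B_disj by (auto simp: disjoint_family_on_def)
    then show "F ` B i \<inter> F ` B j = {}"
      using inj_on_image_Int[OF inj BD BD, of i j] by simp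
  qed
  have "emeasure lborel D = (\<Sum>i. emeasure lborel (B i))"
    using B_borel B_disj by (subst suminf_emeasure) (auto simp: B_un)
  also have "\<dots> \<le> (\<Sum>i. emeasure (area_measure S) (F ` B i))"
    by (intro suminf_le le) auto
  also have "\<dots> = emeasure (area_measure S) (\<Union>i. F ` B i)"
    using FB_sets disj by (intro suminf_emeasure) auto
  also have "\<dots> \<le> emeasure (area_measure S) (topspace X)"
  proof (rule emeasure_mono)
    show "(\<Union>i. F ` B i) \<subseteq> topspace X"
      using developsD(1)[OF dev] BD by blast
    show "topspace X \<in> sets (area_measure S)"
      unfolding sets_eq by (rule sets_open_sigmaI) simp
  qed
  finally show ?thesis
    unfolding vol_def .
qed simp

text \<open>Any singularity will do; the data of \<open>cone_point\<close> at it instantiate the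
  locale \<open>cone_chart\<close>.\<close>

lemma embedded_half_exists:
  assumes "sing S \<noteq> {}" "convex C" "\<And>v. v \<in> C \<Longrightarrow> - v \<in> C" "C \<inter> V_sc S = {}"
  obtains F where "develops S (\<lambda>v. v) ({v. 2 * v \<in> C} - \<real>\<^sub>\<le>\<^sub>0) F" "inj_on F ({v. 2 * v \<in> C} - \<real>\<^sub>\<le>\<^sub>0)"
proof -
  obtain p where p: "p \<in> sing S"
    using assms(1) by blast
  then have "cone_point S p"
    using cone_points by blast
  then obtain k U h r where "cone_chart S p k U h r"
    unfolding cone_point_def cone_chart_def cone_chart_axioms_def
    using translation_surface_axioms by meson
  then interpret cone_chart S p k U h r .
  show ?thesis
    using embedded_half[OF assms(2-4)] that by blast
qed

text \<open>The area of \<open>C\<close> is four times that of its half. Passing to the interior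
  makes the embedded set open and costs only the frontier of a convex set, which is negligible, as
  is the slit along the nonpositive reals.\<close>

lemma convex_area_le:
  assumes "sing S \<noteq> {}" "convex C" "\<And>v. v \<in> C \<Longrightarrow> - v \<in> C" "C \<inter> V_sc S = {}"
  shows "emeasure lebesgue C \<le> 4 * vol S"
proof -
  define I where "I = interior C"
  define D where "D = {v. 2 * v \<in> I} - \<real>\<^sub>\<le>\<^sub>0"
  have "uminus ` C = C"
    using assms(3) by force
  then have sym: "- v \<in> I" if "v \<in> I" for v
    using interior_negations[of C] that unfolding I_def by force
  have "convex I" "I \<inter> V_sc S = {}"
    using assms(2,4) interior_subset[of C] by (auto simp: I_def)
  then obtain F where F: "develops S (\<lambda>v. v) D F" "inj_on F D"
    unfolding D_def using embedded_half_exists[OF assms(1) _ sym] by blast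
  have "open {v. 2 * v \<in> I}"
    using open_vimage[of I "\<lambda>v. 2 * v"] by (auto simp: I_def vimage_def intro!: continuous_intros)
  then have D: "open D"
    unfolding D_def by (intro open_Diff closed_nonpos_Reals_complex)
  \<comment> \<open>The slit lies in the real axis, written as the hyperplane orthogonal to
    \<open>\<i>\<close>.\<close>
  have "\<real>\<^sub>\<le>\<^sub>0 \<subseteq> {z. \<i> \<bullet> z = 0}"
    by (auto simp: complex_nonpos_Reals_iff inner_complex_def)
  then have "negligible (\<real>\<^sub>\<le>\<^sub>0 :: complex set)"
    using negligible_hyperplane[of \<i> 0] negligible_subset by (metis complex_i_not_zero)
  then have null: "\<real>\<^sub>\<le>\<^sub>0 \<union> frontier C \<in> null_sets lebesgue"
    using negligible_convex_frontier[OF assms(2)] by (simp add: negligible_Un flip: negligible_iff_null_sets)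
  have scaled: "open ((\<lambda>v. 2 *\<^sub>R v) ` D)"
    using D by (intro open_scaling) auto
  have "C \<subseteq> (\<lambda>v. 2 *\<^sub>R v) ` D \<union> (\<real>\<^sub>\<le>\<^sub>0 \<union> frontier C)"
  proof
    fix v assume v: "v \<in> C"
    show "v \<in> (\<lambda>v. 2 *\<^sub>R v) ` D \<union> (\<real>\<^sub>\<le>\<^sub>0 \<union> frontier C)"
    proof (cases "v \<in> \<real>\<^sub>\<le>\<^sub>0 \<union> frontier C")
      case False
      then have "v \<in> I"
        using v closure_subset by (auto simp: I_def frontier_def)
      moreover have "v / 2 \<notin> \<real>\<^sub>\<le>\<^sub>0"
        using False by (auto simp: complex_nonpos_Reals_iff)
      ultimately show ?thesis
        by (intro UnI1 image_eqI[of _ _ "v / 2"]) (auto simp: D_def scaleR_conv_of_real)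
    qed simp
  qed
  then have "emeasure lebesgue C \<le> emeasure lebesgue ((\<lambda>v. 2 *\<^sub>R v) ` D \<union> (\<real>\<^sub>\<le>\<^sub>0 \<union> frontier C))"
    using scaled null by (intro emeasure_mono) (auto intro!: sets.Un)
  also have "\<dots> = emeasure lebesgue ((\<lambda>v. 2 *\<^sub>R v) ` D)"
    using scaled null by (intro emeasure_Un_null_set) auto
  \<comment> \<open>Doubling vectors of the plane multiplies area by \<open>2 ^ 2\<close>.\<close>
  also have "\<dots> = 4 * emeasure lborel D"
    using emeasure_lebesgue_affine[of 2 0 D] D by simp
  also have "\<dots> \<le> 4 * vol S"
    by (intro mult_left_mono vol_ge_embedded[OF F(1) D F(2)]) simp
  finally show ?thesis .
qed

end

text \<open>A singularity is assumed because without one \<open>V_sc S\<close> is empty and every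
  bounded symmetric convex set competes, which makes \<open>minkowski_constant\<close>
  infinite.\<close>

theorem theorem1p1:
  fixes S :: "'a flat_surface"
  assumes "compact_translation_surface S"
    and "sing S \<noteq> {}"
  shows "minkowski_constant (V_sc S) \<le> ennreal pi * vol S"
proof -
  interpret translation_surface S
    by unfold_locales (rule assms(1))
  \<comment> \<open>The factor 4 from halving the vectors cancels the normalisation of the Minkowski
    constant.\<close>
  have "minkowski_constant (V_sc S) \<le> 4 * vol S / 4"
    unfolding minkowski_constant_def
    by (intro divide_right_mono_ennreal SUP_least convex_area_le[OF assms(2)]) auto
  also have "\<dots> = vol S"
    by (subst mult.commute) (simp add: ennreal_mult_divide_eq)
  also have "\<dots> = 1 * vol S"
    by simp
  also have "\<dots> \<le> ennreal pi * vol S"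
    using pi_ge_two by (intro mult_right_mono) auto
  finally show ?thesis .
qed

end
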